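(* Let $f\in\mathbb{Q}[x]$ be a square-free polynomial of degree at least $3$, let $m_1,m_2,m_3\ge 3$ be odd integers, and let $a,b,c$ be non-zero rational numbers. Consider the hyperelliptic curves $$E:y^2=f(x),\quad E_1:y^2=x^{m_1}+a^2,\quad E_2:y^2=x^{m_2}+b^2,\quad E_3:y^2=x^{m_3}+c^2.$$ Then there exists a rational function $D\in\mathbb{Q}(u,v_1,v_2,v_3)$ such that the Jacobians of the four curves $$Dy^2=f(x),\quad y^2=Dx^{m_1}+a^2,\quad y^2=Dx^{m_2}+b^2,\quad y^2=Dx^{m_3}+c^2$$ all have positive Mordell–Weil rank over $\mathbb{Q}(u,v_1,v_2,v_3)$.
   Context: $\mathbb{Q}(u,v_1,v_2,v_3)$ is the rational function field in four independent variables. For a rational function $D$, the quadratic twist of $y^2=f(x)$ by $D$ is the curve $Dy^2=f(x)$, and the $m$-twist of $y^2=x^m+\alpha$ by $D$ is the curve $y^2=Dx^m+\alpha$. *)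

theory Defs
  imports
    "HOL-Algebra.Algebraic_Closure_Type"
    "HOL-Algebra.Free_Abelian_Groups"
    "HOL-Computational_Algebra.Computational_Algebra"
    "HOL-Library.Product_Plus"
    "HOL-Library.Extended_Nat"
begin

instance fract :: ("{idom, ring_char_0}") field_char_0
proof
  show "inj (of_nat :: nat \<Rightarrow> 'a fract)"
    by (rule injI) (simp add: of_nat_fract eq_fract)
qed

text \<open>\<open>\<rat>(u, v\<^sub>1, v\<^sub>2, v\<^sub>3)\<close>, as the fraction field of \<open>\<rat>[u][v\<^sub>1][v\<^sub>2][v\<^sub>3]\<close>.\<close>

type_synonym rat_fun4 = "rat poly poly poly poly fract"

subsection \<open>Function fields and places of hyperelliptic curves\<close>

text \<open>
  Let \<open>A \<noteq> 0\<close> and let \<open>g\<close> be a non-constant square-free polynomial over a field \<open>F\<close> of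
  characteristic different from 2.  The function field of the curve \<open>A y\<^sup>2 = g(x)\<close> is
  \<open>F(x)[y] / (A y\<^sup>2 - g(x))\<close>; its element \<open>p + q y\<close> is represented by the pair \<open>(p, q)\<close>
  of rational functions in \<open>x\<close>.  Addition is the componentwise one.
\<close>

type_synonym 'a ff_elem = "'a poly fract \<times> 'a poly fract"

fun ff_mult :: "'a::field \<Rightarrow> 'a poly \<Rightarrow> 'a ff_elem \<Rightarrow> 'a ff_elem \<Rightarrow> 'a ff_elem" where
  "ff_mult A g (p, q) (r, s) = (p * r + Fract g [:A:] * (q * s), p * s + q * r)"

text \<open>
  The closed points of the smooth projective model (those at infinity included) are the
  places of the function field: the normalised discrete valuations that are trivial on the
  constants.  The value at 0, which should be infinity, is fixed to the dummy value 0, so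
  that distinct places are distinct functions and conversely.
\<close>

definition places :: "'a::field \<Rightarrow> 'a poly \<Rightarrow> ('a ff_elem \<Rightarrow> int) set" where
  "places A g = {v.
     v 0 = 0 \<and>
     v ` (- {0}) = UNIV \<and>
     (\<forall>h k. h \<noteq> 0 \<longrightarrow> k \<noteq> 0 \<longrightarrow> v (ff_mult A g h k) = v h + v k) \<and>
     (\<forall>h k. h \<noteq> 0 \<longrightarrow> k \<noteq> 0 \<longrightarrow> h + k \<noteq> 0 \<longrightarrow> min (v h) (v k) \<le> v (h + k)) \<and>
     (\<forall>c. c \<noteq> 0 \<longrightarrow> v (Fract [:c:] 1, 0) = 0)}"

subsection \<open>The degree-zero divisor class group\<close>

text \<open>
  This is meant for an algebraically closed field of constants, where every place has
  degree 1.
\<close>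

definition div0_group :: "'a::field \<Rightarrow> 'a poly \<Rightarrow> (('a ff_elem \<Rightarrow> int) \<Rightarrow>\<^sub>0 int) monoid" where
  "div0_group A g = (free_Abelian_group (places A g))
     \<lparr>carrier := {d \<in> carrier (free_Abelian_group (places A g)).
                    (\<Sum>v\<in>Poly_Mapping.keys d. Poly_Mapping.lookup d v) = 0}\<rparr>"

definition principal_divisors ::
    "'a::field \<Rightarrow> 'a poly \<Rightarrow> (('a ff_elem \<Rightarrow> int) \<Rightarrow>\<^sub>0 int) set" where
  "principal_divisors A g = {d \<in> carrier (div0_group A g).
     \<exists>h. h \<noteq> 0 \<and> (\<forall>v\<in>places A g. Poly_Mapping.lookup d v = v h)}"

definition Pic0 :: "'a::field \<Rightarrow> 'a poly \<Rightarrow> (('a ff_elem \<Rightarrow> int) \<Rightarrow>\<^sub>0 int) set monoid" where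
  "Pic0 A g = div0_group A g Mod principal_divisors A g"

subsection \<open>Galois action and rational points of the Jacobian\<close>

definition galois_group :: "('k::field alg_closure \<Rightarrow> 'k alg_closure) set" where
  "galois_group = {\<sigma>. bij \<sigma> \<and> (\<forall>x y. \<sigma> (x + y) = \<sigma> x + \<sigma> y) \<and>
     (\<forall>x y. \<sigma> (x * y) = \<sigma> x * \<sigma> y) \<and> (\<forall>c. \<sigma> (to_ac c) = to_ac c)}"

definition map_ratfun :: "('a::field \<Rightarrow> 'a) \<Rightarrow> 'a poly fract \<Rightarrow> 'a poly fract" where
  "map_ratfun \<sigma> r = (THE s. \<exists>p q. q \<noteq> 0 \<and> r = Fract p q \<and>
     s = Fract (map_poly \<sigma> p) (map_poly \<sigma> q))"

definition galois_place :: "('a::field \<Rightarrow> 'a) \<Rightarrow> ('a ff_elem \<Rightarrow> int) \<Rightarrow> ('a ff_elem \<Rightarrow> int)" where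
  "galois_place \<sigma> v = (\<lambda>(p, q). v (map_ratfun (inv_into UNIV \<sigma>) p, map_ratfun (inv_into UNIV \<sigma>) q))"

definition galois_divisor ::
    "('a::field \<Rightarrow> 'a) \<Rightarrow> (('a ff_elem \<Rightarrow> int) \<Rightarrow>\<^sub>0 int) \<Rightarrow> (('a ff_elem \<Rightarrow> int) \<Rightarrow>\<^sub>0 int)" where
  "galois_divisor \<sigma> = frag_extend (\<lambda>v. frag_of (galois_place \<sigma> v))"

text \<open>
  For a perfect field \<open>k\<close> and the Jacobian \<open>J\<close> of the curve \<open>A y\<^sup>2 = g(x)\<close> over \<open>k\<close>, the group
  \<open>J(k)\<close> consists of the Galois-invariant elements of \<open>Pic\<^sup>0\<close> of the curve over the algebraic
  closure of \<open>k\<close>.  An invariant class need not contain an invariant divisor.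
\<close>

definition jacobian_points ::
    "'k::field \<Rightarrow> 'k poly \<Rightarrow> (('k alg_closure ff_elem \<Rightarrow> int) \<Rightarrow>\<^sub>0 int) set monoid" where
  "jacobian_points A g = (Pic0 (to_ac A) (map_poly to_ac g))
     \<lparr>carrier := {c \<in> carrier (Pic0 (to_ac A) (map_poly to_ac g)).
                    \<forall>\<sigma>\<in>galois_group. galois_divisor \<sigma> ` c = c}\<rparr>"

subsection \<open>Rank\<close>

definition int_independent :: "('a, 'b) monoid_scheme \<Rightarrow> 'a set \<Rightarrow> bool" where
  "int_independent G S \<longleftrightarrow> S \<subseteq> carrier G \<and> finite S \<and>
     (\<forall>c :: 'a \<Rightarrow> int. finprod G (\<lambda>s. s [^]\<^bsub>G\<^esub> c s) S = \<one>\<^bsub>G\<^esub> \<longrightarrow> (\<forall>s\<in>S. c s = 0))"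

definition abelian_rank :: "('a, 'b) monoid_scheme \<Rightarrow> enat" where
  "abelian_rank G = (SUP S\<in>{S. int_independent G S}. enat (card S))"

definition mordell_weil_rank :: "'k::field \<Rightarrow> 'k poly \<Rightarrow> enat" where
  "mordell_weil_rank A g = abelian_rank (jacobian_points A g)"

end

theory Submission
  imports Defs
begin

text \<open>
  Put \<open>r\<^sub>1 = z\<^bsup>m1\<^esup> / a\<^sup>2\<close>, \<open>r\<^sub>2 = 1 / b\<^sup>2\<close>, \<open>r\<^sub>3 = 1 / c\<^sup>2\<close> for one of the variables \<open>z\<close>.  On the elliptic
  curve \<open>w\<^sup>2 = (1 + r\<^sub>1 t) (1 + r\<^sub>2 t) (1 + r\<^sub>3 t)\<close> the triple of the point \<open>(0, 1)\<close> has a coordinate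
  \<open>t = D0\<close> for which all three factors are squares; so \<open>y\<^sup>2 = D0 x\<^bsup>m\<^esup> + a\<^sup>2\<close> and its two analogues have
  rational points with \<open>x = z, 1, 1\<close>.  Multiplying \<open>D0\<close> by an \<open>m1 m2 m3\<close>-th power turns it into
  \<open>f(z)\<close> times a square, which also gives a rational point with \<open>x = z\<close> on \<open>D y\<^sup>2 = f(x)\<close>.

  Let \<open>P = (x\<^sub>0, y\<^sub>0)\<close> be such a point on \<open>y\<^sup>2 = G(x)\<close> and \<open>P'\<close> its image under the hyperelliptic
  involution.  A function with divisor \<open>n (P - P')\<close> is \<open>(p + q y) / (x - x\<^sub>0)\<^bsup>n\<^esup>\<close> with polynomials \<open>p\<close>
  and \<open>q \<noteq> 0\<close> of small degree such that \<open>p\<^sup>2 - q\<^sup>2 G = c (x - x\<^sub>0)\<^bsup>2n\<^esup>\<close>.  Being a solution of linear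
  equations, \<open>(p, q)\<close> can be taken over the base field.  There is a derivation \<open>d\<close> that maps \<open>G\<close> to
  a constant multiple of itself but moves \<open>x\<^sub>0\<close>; the logarithmic derivative of the function would then
  be a multiple of \<open>y\<close> with at most simple poles at \<open>P\<close> and \<open>P'\<close> and no other poles, hence zero
  because \<open>G\<close> has degree at least 3, whereas its residue at \<open>P\<close> is a non-zero multiple of \<open>n\<close>.
  So \<open>P - P'\<close> has infinite order in the Jacobian.
\<close>

unbundle fps_syntax

subsection \<open>Pell equations and derivations\<close>

lemma derivation_power:
  fixes d :: "'a::comm_ring_1 \<Rightarrow> 'a"
  assumes "\<And>a b. d (a * b) = d a * b + a * d b"
  shows "d (a ^ Suc k) = of_nat (Suc k) * a ^ k * d a"
proof (induction k)
  case (Suc k)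
  have "d (a ^ Suc (Suc k)) = d a * a ^ Suc k + a * d (a ^ Suc k)"
    by (simp only: power_Suc[of a "Suc k"] assms)
  also have "\<dots> = of_nat (Suc (Suc k)) * a ^ Suc k * d a"
    unfolding Suc by (simp add: algebra_simps)
  finally show ?case .
qed auto

text \<open>Descent on \<open>n\<close>: a common zero of \<open>p\<close> and \<open>q\<close> at
  \<open>x0\<close> is cancelled. Otherwise the derivation yields a polynomial whose order at
  \<open>x0\<close> exceeds its degree, so it vanishes, and this vanishing contradicts the value of
  \<open>d [:-x0, 1:]\<close> at \<open>x0\<close>.\<close>

lemma pell_equation_no_solution:
  fixes p q G :: "'a::field_char_0 poly" and d :: "'a poly \<Rightarrow> 'a poly"
  assumes d_add: "\<And>a b. d (a + b) = d a + d b"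
    and d_mult: "\<And>a b. d (a * b) = d a * b + a * d b"
    and d_degree: "\<And>a. degree (d a) \<le> degree a"
    and d_G: "d G = [:2 * l:] * G"
    and d_lin: "poly (d [:-x0, 1:]) x0 \<noteq> 0"
    and G: "poly G x0 \<noteq> 0" "degree G \<ge> 3"
    and "q \<noteq> 0" "c \<noteq> 0" "degree p \<le> n" "2 * degree q + degree G \<le> 2 * n"
    and "p ^ 2 - q ^ 2 * G = [:c:] * [:-x0, 1:] ^ (2 * n)"
  shows False
  using assms(8-12)
proof (induction n arbitrary: p q)
  case 0
  then show ?case using G by simp
next
  case (Suc n p q)
  define L where "L = [:-x0, 1:]"
  define k where "k = 2 * n + 1"
  have poly_L: "poly L x0 = 0" by (simp add: L_def)
  have k: "2 * Suc n = Suc k" by (simp add: k_def)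
  have eq: "p ^ 2 - q ^ 2 * G = [:c:] * L ^ Suc k"
    using Suc.prems(5) by (simp only: L_def k)
  have at_x0: "(poly p x0) ^ 2 = (poly q x0) ^ 2 * poly G x0"
    using arg_cong[OF eq, of "\<lambda>r. poly r x0"] by (simp add: poly_L)
  show ?case
  proof (cases "poly q x0 = 0")
    case True
    with at_x0 have "poly p x0 = 0" by simp
    with True obtain p' q' where p': "p = L * p'" and q': "q = L * q'"
      unfolding L_def poly_eq_0_iff_dvd by (auto elim!: dvdE)
    \<comment> \<open>Cancelling \<open>L ^ 2\<close> lowers the exponent by two and both degree
      bounds accordingly, so the induction hypothesis applies.\<close>
    have "L \<noteq> 0" "degree L = 1" by (auto simp: L_def)
    have "q' \<noteq> 0" using Suc.prems(1) q' by auto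
    then have dq: "degree q = Suc (degree q')"
      using q' \<open>L \<noteq> 0\<close> \<open>degree L = 1\<close> by (simp add: degree_mult_eq)
    have dp: "degree p' \<le> n"
    proof (cases "p' = 0")
      case False
      then show ?thesis
        using p' \<open>L \<noteq> 0\<close> \<open>degree L = 1\<close> Suc.prems(3) by (simp add: degree_mult_eq)
    qed auto
    have "L ^ 2 * (p' ^ 2 - q' ^ 2 * G) = L ^ 2 * ([:c:] * L ^ (2 * n))"
      using eq unfolding p' q' k_def by (simp add: algebra_simps power2_eq_square)
    then have "p' ^ 2 - q' ^ 2 * G = [:c:] * L ^ (2 * n)"
      using \<open>L \<noteq> 0\<close> mult_left_cancel[of "L ^ 2"] by (metis power_not_zero)
    then show ?thesis
      using Suc.IH[of q' p'] \<open>q' \<noteq> 0\<close> Suc.prems(2,4) dp dq by (simp add: L_def)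
  next
    case False
    then have p0: "poly p x0 \<noteq> 0" using at_x0 G by auto
    define N where "N = [:c:] * L ^ Suc k"
    have dN: "d N = d [:c:] * L ^ Suc k + [:c:] * (of_nat (Suc k) * L ^ k * d L)"
      unfolding N_def by (simp only: d_mult derivation_power[of d, OF d_mult])
    have N: "p ^ 2 = N + q ^ 2 * G" using eq by (simp add: N_def algebra_simps)
    have dN': "d (p ^ 2) = d N + d (q ^ 2 * G)" using N by (simp add: d_add)
    then have dpp: "2 * p * d p = d N + 2 * q * d q * G + 2 * q ^ 2 * [:l:] * G"
    proof -
      have "[:2 * l:] = 2 * [:l:]" by (simp add: numeral_poly)
      then show ?thesis
        using dN' by (simp add: power2_eq_square d_mult d_G algebra_simps)
    qed
    \<comment> \<open>If \<open>h = p + q y\<close> with \<open>y\<^sup>2 = G\<close>, then \<open>w\<close> is the \<open>y\<close>-coefficient of \<open>(p - q y) d h\<close>.\<close>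
    define w where "w = p * d q - q * d p + [:l:] * p * q"
    have "2 * (p * w) = 2 * p ^ 2 * d q - q * (2 * p * d p) + 2 * [:l:] * p ^ 2 * q"
      by (simp add: w_def algebra_simps power2_eq_square)
    also have "\<dots> = 2 * N * d q - q * d N + 2 * [:l:] * N * q"
      unfolding dpp N by (simp add: algebra_simps power2_eq_square)
    finally have pw: "2 * (p * w) = 2 * N * d q - q * d N + 2 * [:l:] * N * q" .
    have "L ^ k dvd N" "L ^ k dvd d N"
      unfolding dN unfolding N_def
      by (intro dvd_add dvd_mult[of _ _ "[:c:]"] dvd_mult[of _ "L ^ Suc k"] dvd_mult2[of _ _ "d L"]
          le_imp_power_dvd dvd_mult dvd_refl; simp)+
    then have "L ^ k dvd 2 * (p * w)"
      unfolding pw by (intro dvd_add dvd_diff dvd_mult2[of _ "[:_:] * N" q] dvd_mult2[of _ _ q]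
        dvd_mult2[of _ _ "d q"] dvd_mult)
    moreover have "2 * (p * w) = smult 2 (p * w)" by (simp add: numeral_poly)
    ultimately have "L ^ k dvd p * w" by (metis dvd_smult_cancel zero_neq_numeral)
    \<comment> \<open>As \<open>p\<close> does not vanish at \<open>x0\<close>, the factor
      \<open>L ^ k\<close> with \<open>k = 2 * n + 1\<close> falls entirely on \<open>w\<close>. But
      \<open>degree p \<le> n + 1\<close> and, because \<open>G\<close> has degree at least 3,
      \<open>degree q < n\<close>, so \<open>w\<close> has degree at most
      \<open>2 * n\<close>.\<close>
    have "w = 0"
    proof (rule ccontr)
      assume "w \<noteq> 0"
      have "p \<noteq> 0" using p0 by auto
      have "k \<le> order x0 (p * w)"
        using \<open>L ^ k dvd p * w\<close> \<open>w \<noteq> 0\<close> \<open>p \<noteq> 0\<close> unfolding L_def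
        by (simp add: order_divides)
      then have "k \<le> order x0 w"
        using \<open>w \<noteq> 0\<close> \<open>p \<noteq> 0\<close> p0 by (simp add: order_mult order_0I)
      also have "\<dots> \<le> degree w" using \<open>w \<noteq> 0\<close> by (rule order_degree)
      also have "degree w \<le> degree p + degree q"
        unfolding w_def
        by (intro degree_add_le degree_diff_le order_trans[OF degree_mult_le])
          (use d_degree[of p] d_degree[of q] degree_mult_le[of "[:l:]" p] in auto)
      finally show False using Suc.prems(3,4) G(2) by (simp add: k_def)
    qed
    then have "2 * N * d q + 2 * [:l:] * N * q = q * d N"
      using pw by (simp add: algebra_simps)
    \<comment> \<open>This is the residue computation: after \<open>L ^ k\<close> is cancelled, only
      the term that comes from differentiating \<open>L ^ Suc k\<close> survives at
      \<open>x0\<close>.\<close>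
    then have "L ^ k * ((2 * d q + 2 * [:l:] * q) * [:c:] * L)
        = L ^ k * (q * (d [:c:] * L + of_nat (Suc k) * [:c:] * d L))"
      unfolding dN unfolding N_def by (simp add: algebra_simps)
    moreover have "L ^ k \<noteq> 0" by (simp add: L_def)
    ultimately have "(2 * d q + 2 * [:l:] * q) * [:c:] * L
        = q * (d [:c:] * L + of_nat (Suc k) * [:c:] * d L)"
      using mult_left_cancel by blast
    from arg_cong[OF this, of "\<lambda>r. poly r x0"]
    have "poly q x0 * (of_nat (Suc k) * c * poly (d L) x0) = 0"
      by (simp add: poly_L algebra_simps)
    then show ?thesis
      using False \<open>c \<noteq> 0\<close> d_lin unfolding L_def by (simp del: of_nat_Suc)
  qed
qed

subsection \<open>Ring morphisms and fraction fields\<close>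

locale ring_morphism =
  fixes h :: "'a::idom \<Rightarrow> 'b::idom"
  assumes hom_add: "h (x + y) = h x + h y"
    and hom_mult: "h (x * y) = h x * h y"
    and hom_one: "h 1 = 1"
begin

lemma hom_zero: "h 0 = 0"
  using hom_add[of 0 0] by (metis add_0 add_cancel_right_right)

lemma hom_uminus: "h (- x) = - h x"
  using hom_add[of x "- x"] hom_zero by (simp add: eq_neg_iff_add_eq_0 add.commute)

lemma hom_diff: "h (x - y) = h x - h y"
  using hom_add[of x "- y"] hom_uminus by simp

lemma hom_power: "h (x ^ n) = h x ^ n"
  by (induction n) (simp_all add: hom_one hom_mult)

lemmas hom_simps = hom_add hom_mult hom_one hom_zero hom_uminus hom_diff hom_power

lemma ring_morphism_map_poly: "ring_morphism (map_poly h)"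
proof
  show add: "map_poly h (p + q) = map_poly h p + map_poly h q" for p q
    by (intro poly_eqI) (simp add: coeff_map_poly hom_simps)
  show "map_poly h (p * q) = map_poly h p * map_poly h q" for p q
    by (induction p)
      (simp_all add: map_poly_pCons map_poly_smult add hom_simps)
qed (simp add: hom_one)

lemma poly_hom: "poly (map_poly h p) (h x) = h (poly p x)"
  by (induction p) (simp_all add: map_poly_pCons hom_simps)

lemma pderiv_hom: "pderiv (map_poly h p) = map_poly h (pderiv p)"
proof -
  have "h (of_nat n) = of_nat n" for n
    by (induction n) (simp_all add: hom_simps)
  then show ?thesis
    by (intro poly_eqI) (simp add: coeff_pderiv coeff_map_poly hom_simps del: of_nat_Suc)
qed

lemma ring_morphism_eval_poly: "ring_morphism (\<lambda>p. poly (map_poly h p) t)"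
proof -
  interpret m: ring_morphism "map_poly h" by (rule ring_morphism_map_poly)
  show ?thesis by unfold_locales (simp_all add: m.hom_simps)
qed

end

text \<open>The description has the same shape as that of \<open>map_ratfun\<close>, so that the
  Galois action on rational functions becomes an instance of this lift.\<close>

definition fract_lift :: "('a::idom \<Rightarrow> 'b::field) \<Rightarrow> 'a fract \<Rightarrow> 'b" where
  "fract_lift h r = (THE s. \<exists>p q. q \<noteq> 0 \<and> r = Fract p q \<and> s = h p / h q)"

locale fract_morphism = ring_morphism h for h :: "'a::idom \<Rightarrow> 'b::field" +
  assumes hom_nonzero: "x \<noteq> 0 \<Longrightarrow> h x \<noteq> 0"
begin

lemma fract_lift_Fract:
  assumes "q \<noteq> 0"
  shows "fract_lift h (Fract p q) = h p / h q"
  unfolding fract_lift_def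
proof (rule the_equality)
  fix s assume "\<exists>p' q'. q' \<noteq> 0 \<and> Fract p q = Fract p' q' \<and> s = h p' / h q'"
  then obtain p' q' where *: "q' \<noteq> 0" "Fract p q = Fract p' q'" "s = h p' / h q'" by blast
  then have "h (p * q') = h (p' * q)" using assms by (simp add: eq_fract)
  then show "s = h p / h q"
    using *(3) hom_nonzero[OF assms] hom_nonzero[OF *(1)]
    by (simp add: hom_mult frac_eq_eq)
qed (use assms in blast)

sublocale lift: ring_morphism "fract_lift h"
proof
  show "fract_lift h (x + y) = fract_lift h x + fract_lift h y" for x y
    by (cases x; cases y)
      (simp add: fract_lift_Fract hom_simps hom_nonzero add_frac_eq)
  show "fract_lift h (x * y) = fract_lift h x * fract_lift h y" for x y
    by (cases x; cases y) (simp add: fract_lift_Fract hom_simps)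
qed (simp add: One_fract_def fract_lift_Fract hom_simps)

lemma fract_lift_eq_0_iff: "fract_lift h x = 0 \<longleftrightarrow> x = 0"
  by (cases x) (auto simp: fract_lift_Fract Zero_fract_def eq_fract hom_zero hom_nonzero
      dest: hom_nonzero)

lemma fract_lift_inverse: "fract_lift h (inverse x) = inverse (fract_lift h x)"
proof (cases "x = 0")
  case False
  then have "fract_lift h x * fract_lift h (inverse x) = 1"
    by (simp flip: lift.hom_mult add: lift.hom_one)
  then show ?thesis by (metis inverse_unique)
qed (simp add: lift.hom_zero)

lemma fract_lift_power_int: "fract_lift h (x powi n) = fract_lift h x powi n"
  by (simp add: power_int_def lift.hom_power fract_lift_inverse)

end

lemma Fract_common_denominator:
  obtains p q d where "d \<noteq> 0" "P = Fract p d" "Q = Fract q d"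
proof (cases P, cases Q)
  fix a b a' b' assume *: "P = Fract a b" "b \<noteq> 0" "Q = Fract a' b'" "b' \<noteq> 0"
  show thesis
    by (rule that[of "b * b'" "a * b'" "a' * b"]) (use * in \<open>simp_all add: eq_fract\<close>)
qed

subsection \<open>Laurent series\<close>

lemma ring_morphism_fls_const: "ring_morphism (fls_const :: 'a::idom \<Rightarrow> 'a fls)"
  by unfold_locales (simp_all add: fls_plus_const fls_const_mult_const)

text \<open>Here \<open>T\<close> plays the local expansion of the coordinate \<open>x\<close>: it
  will be \<open>x1 + X ^ e\<close> at a finite point and \<open>X ^ (-e)\<close> at
  infinity.\<close>

definition subst_fls :: "'a::field fls \<Rightarrow> 'a poly \<Rightarrow> 'a fls" where
  "subst_fls T p = poly (map_poly fls_const p) T"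

lemma ring_morphism_subst_fls: "ring_morphism (subst_fls T)"
  using ring_morphism.ring_morphism_eval_poly[OF ring_morphism_fls_const]
  unfolding subst_fls_def .

lemma subst_fls_pCons: "subst_fls T (pCons a p) = fls_const a + T * subst_fls T p"
  by (simp add: subst_fls_def map_poly_pCons)

lemma subst_fls_0 [simp]: "subst_fls T 0 = 0"
  by (simp add: subst_fls_def)

text \<open>Over an algebraically closed field a polynomial is a constant times linear factors, so
  orders under substitution can be computed one factor at a time.\<close>

lemma alg_closed_poly_induct [consumes 1, case_names const mult]:
  fixes p :: "'a::alg_closed_field poly"
  assumes "p \<noteq> 0"
    and const: "\<And>c. c \<noteq> 0 \<Longrightarrow> P [:c:]"
    and mult: "\<And>r p. p \<noteq> 0 \<Longrightarrow> P p \<Longrightarrow> P ([:-r, 1:] * p)"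
  shows "P p"
  using \<open>p \<noteq> 0\<close>
proof (induction "degree p" arbitrary: p)
  case 0
  then obtain c where "p = [:c:]" by (metis degree_eq_zeroE)
  then show ?case using 0 const by auto
next
  case (Suc n)
  then obtain r where "poly p r = 0" using alg_closed_imp_poly_has_root[of p] by auto
  then obtain p' where p': "p = [:-r, 1:] * p'" unfolding poly_eq_0_iff_dvd by (elim dvdE)
  with Suc.prems have "p' \<noteq> 0" by auto
  then have "degree p = Suc (degree p')" unfolding p' by (subst degree_mult_eq) auto
  then show ?case using Suc p' \<open>p' \<noteq> 0\<close> mult by simp
qed

lemma subst_fls_linear: "subst_fls T [:-r, 1:] = T - fls_const r"
  by (simp add: subst_fls_pCons)

text \<open>A non-constant series is transcendental over algebraically closed constants, because
  none of the linear factors \<open>T - r\<close> vanishes.\<close>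

lemma subst_fls_nonzero:
  fixes T :: "'a::alg_closed_field fls"
  assumes "\<And>r. T \<noteq> fls_const r" "p \<noteq> 0"
  shows "subst_fls T p \<noteq> 0"
  using \<open>p \<noteq> 0\<close>
proof (induction p rule: alg_closed_poly_induct)
  case (const c)
  then show ?case by (simp add: subst_fls_pCons)
next
  case (mult r p)
  interpret ring_morphism "subst_fls T" by (rule ring_morphism_subst_fls)
  show ?case using mult assms(1)[of r] unfolding hom_mult subst_fls_linear by simp
qed

lemma fract_morphism_subst_fls:
  fixes T :: "'a::alg_closed_field fls"
  assumes "\<And>r. T \<noteq> fls_const r"
  shows "fract_morphism (subst_fls T)"
  using ring_morphism_subst_fls subst_fls_nonzero[OF assms]
  by (auto simp: fract_morphism_def fract_morphism_axioms_def)

text \<open>The assumption on orders says that \<open>T\<close> takes the value \<open>x0\<close>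
  with multiplicity \<open>e\<close>. A linear factor then contributes \<open>e\<close> if its root
  is \<open>x0\<close>, and 0 otherwise.\<close>

lemma subdegree_subst_fls_finite:
  fixes T :: "'a::alg_closed_field fls"
  assumes T: "\<And>r. T \<noteq> fls_const r"
    and sub: "\<And>r. fls_subdegree (T - fls_const r) = (if r = x0 then e else 0)"
    and "p \<noteq> 0"
  shows "fls_subdegree (subst_fls T p) = e * int (order x0 p)"
  using \<open>p \<noteq> 0\<close>
proof (induction p rule: alg_closed_poly_induct)
  case (const c)
  then show ?case by (simp add: subst_fls_pCons order_0I)
next
  case (mult r p)
  interpret ring_morphism "subst_fls T" by (rule ring_morphism_subst_fls)
  have "[:-r, 1:] * p \<noteq> 0" using mult.hyps by (simp del: mult_pCons_left)
  then have "order x0 ([:-r, 1:] * p) = order x0 [:-r, 1:] + order x0 p"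
    by (rule order_mult)
  moreover have "order x0 [:-r, 1:] = (if r = x0 then 1 else 0)"
    using order_power_n_n[of x0 1] by (auto intro: order_0I)
  moreover have "T - fls_const r \<noteq> 0" using T by simp
  ultimately show ?case
    using mult.IH sub[of r] subst_fls_nonzero[OF T mult.hyps]
    unfolding hom_mult subst_fls_linear by (simp add: distrib_left)
qed

text \<open>All differences \<open>T - r\<close> have the same order, as at a pole of
  \<open>x\<close>, so every linear factor contributes equally, whatever its root.\<close>

lemma subdegree_subst_fls_infinite:
  fixes T :: "'a::alg_closed_field fls"
  assumes T: "\<And>r. T \<noteq> fls_const r"
    and sub: "\<And>r. fls_subdegree (T - fls_const r) = - e"
    and "p \<noteq> 0"
  shows "fls_subdegree (subst_fls T p) = - e * int (degree p)"
  using \<open>p \<noteq> 0\<close>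
proof (induction p rule: alg_closed_poly_induct)
  case (const c)
  then show ?case by (simp add: subst_fls_pCons)
next
  case (mult r p)
  interpret ring_morphism "subst_fls T" by (rule ring_morphism_subst_fls)
  have "degree ([:-r, 1:] * p) = Suc (degree p)"
    using mult by (subst degree_mult_eq) auto
  moreover have "T - fls_const r \<noteq> 0" using T by simp
  ultimately show ?case
    using mult.IH sub[of r] subst_fls_nonzero[OF T mult.hyps]
    unfolding hom_mult subst_fls_linear by (simp add: distrib_left)
qed

text \<open>Evenness lets half of the order be split off as a shift. What remains is a power series
  with non-zero constant term, which in characteristic 0 has a square root as soon as its constant
  term has one.\<close>

lemma fls_square_root_exists:
  fixes Z :: "'a::{alg_closed_field, field_char_0} fls"
  assumes "Z \<noteq> 0" "even (fls_subdegree Z)"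
  obtains Y where "Y ^ 2 = Z"
proof -
  define F where "F = fls_base_factor_to_fps Z"
  have F0: "F $ 0 \<noteq> 0" using fls_base_factor_to_fps_base[OF assms(1)] by (simp add: F_def)
  have "\<exists>y. y ^ 2 = F $ 0" using nth_root_exists[of 2 "F $ 0"] by auto
  then obtain y where y: "y ^ 2 = F $ 0" by blast
  have "fps_radical (\<lambda>_ _. y) 2 F ^ 2 = F"
    using power_radical[OF F0, of "\<lambda>_ _. y" 1] y by (simp add: numeral_2_eq_2)
  then obtain S where S: "S ^ 2 = F" by blast
  obtain k where k: "fls_subdegree Z = 2 * k" using assms(2) by (elim evenE)
  have "Z = fls_shift (- fls_subdegree Z) (fps_to_fls F)"
    unfolding F_def by (rule fls_conv_base_factor_to_fps_shift_subdegree)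
  also have "\<dots> = (fls_shift (- k) (fps_to_fls S)) ^ 2"
    unfolding k S[symmetric] power2_eq_square
    by (simp add: fls_times_both_shifted_simp fls_times_fps_to_fls)
  finally show thesis using that by metis
qed

text \<open>The Galois group acts on local expansions through their coefficients; the invariance of
  the two places of interest is proved with this action.\<close>

definition fls_map :: "('a \<Rightarrow> 'a) \<Rightarrow> 'a::field fls \<Rightarrow> 'a fls" where
  "fls_map \<sigma> F = Abs_fls (\<lambda>n. \<sigma> (F $$ n))"

lemma fls_nth_map:
  assumes "\<sigma> 0 = 0"
  shows "fls_map \<sigma> F $$ n = \<sigma> (F $$ n)"
  unfolding fls_map_def
  by (rule nth_Abs_fls_lower_bound[of "fls_subdegree F"]) (simp add: assms)

lemma fls_subdegree_map:
  assumes "\<And>x. \<sigma> x = 0 \<longleftrightarrow> x = 0"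
  shows "fls_subdegree (fls_map \<sigma> F) = fls_subdegree F"
proof (cases "F = 0")
  case True
  then have "fls_map \<sigma> F = 0" by (intro fls_eqI) (simp add: fls_nth_map assms)
  then show ?thesis using True by simp
next
  case False
  then show ?thesis by (intro fls_subdegree_eqI) (simp_all add: fls_nth_map assms)
qed

lemma ring_morphism_fls_map:
  assumes "ring_morphism \<sigma>" "\<And>x. \<sigma> x = 0 \<longleftrightarrow> x = 0"
  shows "ring_morphism (fls_map \<sigma>)"
proof -
  interpret ring_morphism \<sigma> by fact
  have [simp]: "\<sigma> (sum f S) = (\<Sum>i\<in>S. \<sigma> (f i))" for f :: "int \<Rightarrow> _" and S
    by (induction S rule: infinite_finite_induct) (simp_all add: hom_simps)
  show ?thesis
  proof
    show "fls_map \<sigma> (F + H) = fls_map \<sigma> F + fls_map \<sigma> H" for F H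
      by (intro fls_eqI) (simp add: fls_nth_map hom_simps)
    show "fls_map \<sigma> (F * H) = fls_map \<sigma> F * fls_map \<sigma> H" for F H
    proof (intro fls_eqI)
      fix n
      \<comment> \<open>The coefficients of a product are sums over a range bounded by the two
        orders; equal orders make the ranges agree.\<close>
      have "fls_subdegree (fls_map \<sigma> F) = fls_subdegree F" "fls_subdegree (fls_map \<sigma> H) = fls_subdegree H"
        using assms(2) by (auto intro: fls_subdegree_map)
      then show "fls_map \<sigma> (F * H) $$ n = (fls_map \<sigma> F * fls_map \<sigma> H) $$ n"
        unfolding fls_times_nth(2)[of "fls_map \<sigma> F"]
        by (simp add: fls_nth_map hom_zero fls_times_nth(2)[of F] hom_mult)
    qed
    show "fls_map \<sigma> 1 = 1"
      by (intro fls_eqI) (simp add: fls_nth_map hom_simps)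
  qed
qed

subsection \<open>Function fields and places given by Laurent series\<close>

definition ff_conj :: "'a::field ff_elem \<Rightarrow> 'a ff_elem" where
  "ff_conj h = (fst h, - snd h)"

abbreviation fls_lift :: "'a::field fls \<Rightarrow> 'a poly fract \<Rightarrow> 'a fls" where
  "fls_lift T \<equiv> fract_lift (subst_fls T)"

text \<open>With \<open>T\<close> and \<open>Y\<close> the expansions of \<open>x\<close> and
  \<open>y\<close> at a point, this embeds the function field into Laurent series. Replacing
  \<open>Y\<close> by \<open>- Y\<close> passes to the conjugate point.\<close>

definition ff_series :: "'a::field fls \<Rightarrow> 'a fls \<Rightarrow> 'a ff_elem \<Rightarrow> 'a fls" where
  "ff_series T Y h = fls_lift T (fst h) + fls_lift T (snd h) * Y"

definition series_place :: "'a::field fls \<Rightarrow> 'a fls \<Rightarrow> 'a ff_elem \<Rightarrow> int" where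
  "series_place T Y h = fls_subdegree (ff_series T Y h)"

lemma places_mult:
  "v \<in> places A g \<Longrightarrow> h \<noteq> 0 \<Longrightarrow> k \<noteq> 0 \<Longrightarrow> v (ff_mult A g h k) = v h + v k"
  unfolding places_def by blast

lemma places_one: "v \<in> places A g \<Longrightarrow> v (1, 0) = 0"
  unfolding places_def by (simp add: One_fract_def one_pCons)

text \<open>Over an algebraically closed field divisibility can be tested root by root: a linear
  factor of \<open>d\<close> also occurs in \<open>p\<close>, and cancelling it preserves the
  comparison of orders.\<close>

lemma order_le_imp_dvd:
  fixes d p :: "'a::alg_closed_field poly"
  assumes "d \<noteq> 0" "p \<noteq> 0" "\<And>x. order x d \<le> order x p"
  shows "d dvd p"
  using assms
proof (induction d arbitrary: p rule: alg_closed_poly_induct)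
  case (const c)
  then show ?case by (metis degree_pCons_0 is_unit_iff_degree pCons_eq_0_iff unit_imp_dvd)
next
  case (mult r d)
  have nz: "[:-r, 1:] * d \<noteq> 0" using mult.hyps by (simp del: mult_pCons_left)
  have ord: "order x ([:-r, 1:] * d) = (if x = r then 1 else 0) + order x d" for x
    using nz order_power_n_n[of r 1] by (subst order_mult) (auto intro: order_0I)
  have "order r p \<noteq> 0" using mult.prems(2)[of r] ord[of r] by simp
  then obtain p' where p': "p = [:-r, 1:] * p'"
    by (metis dvdE order_0I poly_eq_0_iff_dvd)
  with mult.prems(1) have nz': "[:-r, 1:] * p' \<noteq> 0" by simp
  have ord': "order x p = (if x = r then 1 else 0) + order x p'" for x
    unfolding p' using nz' order_power_n_n[of r 1] by (subst order_mult) (auto intro: order_0I)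
  have "d dvd p'"
  proof (rule mult.IH)
    show "p' \<noteq> 0" using nz' by auto
    show "order x d \<le> order x p'" for x
      using mult.prems(2)[of x] ord[of x] ord'[of x] by simp
  qed
  then show ?case unfolding p' by (rule mult_dvd_mono[OF dvd_refl])
qed

text \<open>A rational function whose only finite pole is at \<open>x0\<close>, with order at most
  \<open>n\<close>, becomes a polynomial after multiplication by the \<open>n\<close>-th power of
  the linear factor, as a comparison of orders shows.\<close>

lemma Fract_power_denominator:
  fixes R :: "'a::alg_closed_field poly fract"
  assumes "\<And>p d x. d \<noteq> 0 \<Longrightarrow> p \<noteq> 0 \<Longrightarrow> R = Fract p d \<Longrightarrow>
      order x d \<le> order x p + (if x = x0 then n else 0)"
  obtains p where "R = Fract p ([:-x0, 1:] ^ n)"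
proof (cases R)
  case (Fract p d)
  define L where "L = [:-x0, 1:]"
  have L: "L \<noteq> 0" by (simp add: L_def)
  show thesis
  proof (cases "p = 0")
    case True
    then have "R = Fract 0 (L ^ n)" using Fract L by (simp add: eq_fract)
    then show thesis using that unfolding L_def by blast
  next
    case False
    have "order x d \<le> order x (p * L ^ n)" for x
    proof -
      have "order x (L ^ n) = (if x = x0 then n else 0)"
        unfolding L_def using order_power_n_n[of x0 n] by (auto intro!: order_0I)
      moreover have "order x (p * L ^ n) = order x p + order x (L ^ n)"
        using False L by (intro order_mult) simp
      ultimately show ?thesis using assms[OF _ False Fract(1)] Fract(2) by simp
    qed
    then have "d dvd p * L ^ n" using order_le_imp_dvd[OF Fract(2)] False L by simp
    then obtain p' where "p * L ^ n = d * p'" by (elim dvdE)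
    then have "R = Fract p' (L ^ n)" using Fract L by (simp add: eq_fract mult.commute)
    then show thesis using that unfolding L_def by blast
  qed
qed

section \<open>The function field of a hyperelliptic curve over an algebraically closed
  field\<close>

locale curve =
  fixes A :: "'a::{alg_closed_field, field_char_0}" and g :: "'a poly"
  assumes A_nonzero: "A \<noteq> 0"
    and simple_roots: "poly g x = 0 \<Longrightarrow> poly (pderiv g) x \<noteq> 0"
    and degree_g: "degree g \<ge> 3"
begin

definition G :: "'a poly" where "G = smult (inverse A) g"

lemma Fract_G: "Fract g [:A:] = Fract G 1"
  using A_nonzero by (simp add: eq_fract G_def)

lemma degree_G: "degree G = degree g"
  using A_nonzero by (simp add: G_def)

lemma G_nonzero: "G \<noteq> 0"
  using degree_G degree_g by auto

lemma order_G:
  assumes "poly G x = 0"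
  shows "order x G = 1"
proof -
  have "rsquarefree G"
    unfolding rsquarefree_roots
    using simple_roots A_nonzero by (auto simp: G_def pderiv_smult)
  then show ?thesis using assms G_nonzero by (rule rsquarefree_root_order)
qed

lemma ff_mult_eq:
  "ff_mult A g h k = (fst h * fst k + Fract G 1 * (snd h * snd k), fst h * snd k + snd h * fst k)"
  by (cases h; cases k) (simp add: Fract_G)

text \<open>At a root of \<open>G\<close>, which is simple, a non-zero square has even order whereas
  \<open>q ^ 2 * G\<close> has odd order.\<close>

lemma G_not_square:
  assumes "p ^ 2 = q ^ 2 * G"
  shows "p = 0" "q = 0"
proof -
  have "q = 0"
  proof (rule ccontr)
    assume "q \<noteq> 0"
    obtain x where x: "poly G x = 0"
      using alg_closed_imp_poly_has_root[of G] degree_G degree_g by auto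
    have "p \<noteq> 0" using assms \<open>q \<noteq> 0\<close> G_nonzero by auto
    have "order x (p * p) = order x (q * q * G)" using assms by (simp add: power2_eq_square)
    then have "order x p + order x p = order x q + order x q + order x G"
      using \<open>p \<noteq> 0\<close> \<open>q \<noteq> 0\<close> G_nonzero by (simp add: order_mult)
    then show False using order_G[OF x] by presburger
  qed
  then show "p = 0" "q = 0" using assms by auto
qed

text \<open>The norm from the function field down to the rational functions in \<open>x\<close>. Its
  non-vanishing gives inverses and excludes zero divisors.\<close>

definition ff_norm :: "'a ff_elem \<Rightarrow> 'a poly fract" where
  "ff_norm h = fst h ^ 2 - Fract G 1 * snd h ^ 2"

lemma ff_norm_nonzero:
  assumes "h \<noteq> 0"
  shows "ff_norm h \<noteq> 0"
proof
  assume *: "ff_norm h = 0"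
  obtain p q d where d: "d \<noteq> 0" "fst h = Fract p d" "snd h = Fract q d"
    by (rule Fract_common_denominator)
  have "Fract p d ^ 2 = Fract G 1 * Fract q d ^ 2"
    using * by (simp add: ff_norm_def d(2,3))
  then have "(p * p) * (d * d) = (G * (q * q)) * (d * d)"
    using d(1) by (simp add: power2_eq_square eq_fract)
  then have "p ^ 2 = q ^ 2 * G" using d(1) by (simp add: power2_eq_square mult_ac)
  from G_not_square[OF this] have "fst h = 0" "snd h = 0"
    using d by (simp_all add: Zero_fract_def eq_fract)
  then show False using assms by (simp add: prod_eq_iff)
qed

lemma ff_mult_inverse_exists:
  assumes "h \<noteq> 0"
  obtains k where "k \<noteq> 0" "ff_mult A g h k = (1, 0)"
proof
  let ?k = "(fst h / ff_norm h, - snd h / ff_norm h)"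
  have "fst h * (fst h / ff_norm h) + Fract G 1 * (snd h * (- snd h / ff_norm h))
      = (fst h ^ 2 - Fract G 1 * snd h ^ 2) / ff_norm h"
    by (simp add: diff_divide_distrib power2_eq_square)
  also have "\<dots> = 1"
    using ff_norm_nonzero[OF assms] by (simp add: ff_norm_def)
  finally show "ff_mult A g h ?k = (1, 0)"
    by (simp add: ff_mult_eq)
  then show "?k \<noteq> 0"
    by (auto simp: ff_mult_eq zero_prod_def)
qed

lemma place_inverse:
  assumes "v \<in> places A g" "h \<noteq> 0" "k \<noteq> 0" "ff_mult A g h k = (1, 0)"
  shows "v k = - v h"
proof -
  have "v (ff_mult A g h k) = v h + v k" using assms(1-3) by (rule places_mult)
  then show ?thesis using assms(4) places_one[OF assms(1)] by simp
qed

lemma ff_mult_nonzero: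
  assumes "h \<noteq> 0" "k \<noteq> 0"
  shows "ff_mult A g h k \<noteq> 0"
proof
  assume "ff_mult A g h k = 0"
  moreover have "ff_norm (ff_mult A g h k) = ff_norm h * ff_norm k"
  proof -
    have "(a * c + F * (b * d)) ^ 2 - F * (a * d + b * c) ^ 2
        = (a ^ 2 - F * b ^ 2) * (c ^ 2 - F * d ^ 2)" for a b c d F :: "'a poly fract"
      by (simp add: power2_eq_square algebra_simps)
    then show ?thesis by (simp add: ff_norm_def ff_mult_eq)
  qed
  moreover have "ff_norm 0 = 0" by (simp add: ff_norm_def)
  ultimately show False using ff_norm_nonzero assms by auto
qed

end

section \<open>Places read off from local expansions\<close>

locale curve_series = curve A g for A :: "'a::{alg_closed_field, field_char_0}" and g +
  fixes T Y :: "'a fls"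
  assumes T_nonconst: "T \<noteq> fls_const r" and Y_square: "Y ^ 2 = subst_fls T G"
begin

sublocale subst: fract_morphism "subst_fls T"
  using T_nonconst by (rule fract_morphism_subst_fls)

lemma fls_lift_poly: "fls_lift T (Fract p 1) = subst_fls T p"
  by (simp add: subst.fract_lift_Fract subst.hom_one)

lemma ff_series_mult: "ff_series T Y (ff_mult A g h k) = ff_series T Y h * ff_series T Y k"
proof -
  have "ff_series T Y h * ff_series T Y k = fls_lift T (fst h) * fls_lift T (fst k)
      + Y ^ 2 * (fls_lift T (snd h) * fls_lift T (snd k))
      + (fls_lift T (fst h) * fls_lift T (snd k) + fls_lift T (snd h) * fls_lift T (fst k)) * Y"
    by (simp add: ff_series_def algebra_simps power2_eq_square)
  then show ?thesis
    by (simp add: Y_square fls_lift_poly[symmetric] ff_series_def ff_mult_eq subst.lift.hom_add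
        subst.lift.hom_mult)
qed

lemma ff_series_add: "ff_series T Y (h + k) = ff_series T Y h + ff_series T Y k"
  by (simp add: ff_series_def subst.lift.hom_simps algebra_simps)

text \<open>Multiplying by the expansion of the conjugate element gives the expansion of the norm,
  which is a non-zero rational function in \<open>x\<close>.\<close>

lemma ff_series_nonzero:
  assumes "h \<noteq> 0"
  shows "ff_series T Y h \<noteq> 0"
proof
  assume *: "ff_series T Y h = 0"
  have "ff_series T Y h * ff_series T Y (ff_conj h)
      = fls_lift T (fst h) ^ 2 - Y ^ 2 * fls_lift T (snd h) ^ 2"
    by (simp add: ff_series_def ff_conj_def subst.lift.hom_uminus power2_eq_square algebra_simps)
  also have "\<dots> = fls_lift T (ff_norm h)"
    by (simp add: ff_norm_def subst.lift.hom_diff subst.lift.hom_mult subst.lift.hom_power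
        fls_lift_poly Y_square)
  finally have "fls_lift T (ff_norm h) = ff_series T Y h * ff_series T Y (ff_conj h)" ..
  then show False using * ff_norm_nonzero[OF assms] subst.fract_lift_eq_0_iff by simp
qed

text \<open>Of the valuation axioms, surjectivity needs the assumption. Either some function of
  \<open>x\<close> has order 1, or some function of \<open>x\<close> has order 2 and its powers give
  the even values, while \<open>y\<close> times these powers gives the odd ones; the latter happens
  at branch points.\<close>

lemma series_place_in_places:
  assumes "fls_subdegree (fls_lift T R) = 1 \<or>
    fls_subdegree (fls_lift T R) = 2 \<and> odd (fls_subdegree Y)"
  shows "series_place T Y \<in> places A g"
  unfolding places_def mem_Collect_eq
proof (intro conjI allI impI)
  show "series_place T Y 0 = 0"
    by (simp add: series_place_def ff_series_def subst.lift.hom_zero)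
  show "series_place T Y (ff_mult A g h k) = series_place T Y h + series_place T Y k"
    if "h \<noteq> 0" "k \<noteq> 0" for h k
    using that ff_series_nonzero by (simp add: series_place_def ff_series_mult)
  show "min (series_place T Y h) (series_place T Y k) \<le> series_place T Y (h + k)"
    if "h \<noteq> 0" "k \<noteq> 0" "h + k \<noteq> 0" for h k
    using that(3) ff_series_nonzero[of "h + k"] unfolding series_place_def ff_series_add
    by (intro fls_plus_subdegree) (simp add: ff_series_add)
  show "series_place T Y (Fract [:c:] 1, 0) = 0" if "c \<noteq> 0" for c
    using that
    by (simp add: series_place_def ff_series_def fls_lift_poly subst_fls_pCons subst.lift.hom_zero)
  have R: "R \<noteq> 0" using assms subst.lift.hom_zero by auto
  have "Y \<noteq> 0" using Y_square subst.hom_nonzero[OF G_nonzero] by auto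
  have surj: "\<exists>h. h \<noteq> 0 \<and> series_place T Y h = k" for k
  proof (cases "fls_subdegree (fls_lift T R) = 1")
    case True
    let ?h = "(R powi k, 0) :: 'a ff_elem"
    have "series_place T Y ?h = k"
      using True by (simp add: series_place_def ff_series_def subst.fract_lift_power_int
          subst.lift.hom_zero)
    moreover have "?h \<noteq> 0" using R by (simp add: zero_prod_def)
    ultimately show ?thesis by blast
  next
    case False
    then have R2: "fls_subdegree (fls_lift T R) = 2" and odd: "odd (fls_subdegree Y)"
      using assms by auto
    show ?thesis
    proof (cases "even k")
      case True
      then obtain j where j: "k = 2 * j" by (elim evenE)
      let ?h = "(R powi j, 0) :: 'a ff_elem"
      have "series_place T Y ?h = k"
        using R2 j by (simp add: series_place_def ff_series_def subst.fract_lift_power_int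
            subst.lift.hom_zero)
      moreover have "?h \<noteq> 0" using R by (simp add: zero_prod_def)
      ultimately show ?thesis by blast
    next
      case False
      then have "even (k - fls_subdegree Y)" using odd by simp
      then obtain j where "k - fls_subdegree Y = 2 * j" by (elim evenE)
      then have j: "k = 2 * j + fls_subdegree Y" by simp
      let ?h = "(0, R powi j) :: 'a ff_elem"
      have "fls_lift T (R powi j) \<noteq> 0" using R by (simp add: subst.fract_lift_eq_0_iff)
      then have "series_place T Y ?h = k"
        using R2 j \<open>Y \<noteq> 0\<close> by (simp add: series_place_def ff_series_def
            subst.fract_lift_power_int subst.lift.hom_zero)
      moreover have "?h \<noteq> 0" using R by (simp add: zero_prod_def)
      ultimately show ?thesis by blast
    qed
  qed
  have "k \<in> series_place T Y ` (- {0})" for k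
    using surj[of k] by (auto intro: rev_image_eqI)
  then show "series_place T Y ` (- {0}) = UNIV" by auto
qed

lemma curve_series_minus: "curve_series A g T (- Y)"
  by unfold_locales (use T_nonconst Y_square in auto)

text \<open>The two components are half the sum and half the difference of the expansions at
  conjugate points, so bounds on the poles at both points are inherited.\<close>

lemma components_subdegree_ge:
  assumes "series_place T Y h \<ge> - n" "series_place T (- Y) h \<ge> - n" "h \<noteq> 0"
  shows "fst h \<noteq> 0 \<Longrightarrow> fls_subdegree (fls_lift T (fst h)) \<ge> - n"
    and "snd h \<noteq> 0 \<Longrightarrow> fls_subdegree (fls_lift T (snd h)) + fls_subdegree Y \<ge> - n"
proof -
  interpret neg: curve_series A g T "- Y" by (rule curve_series_minus)
  define a b where "a = ff_series T Y h" and "b = ff_series T (- Y) h"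
  have ab: "fls_subdegree a \<ge> - n" "fls_subdegree b \<ge> - n"
    using assms(1,2) by (simp_all add: a_def b_def series_place_def)
  have half: "fls_subdegree (fls_const (1 / 2) * F) = fls_subdegree F" for F :: "'a fls"
    by (cases "F = 0") auto
  have two: "fls_const (1 / 2) * (2 * F) = F" for F :: "'a fls"
    by (intro fls_eqI) (simp add: mult_2 flip: mult_2)
  have *: "a + b = 2 * fls_lift T (fst h)" "a - b = 2 * (fls_lift T (snd h) * Y)"
    by (simp_all add: a_def b_def ff_series_def)
  have "Y \<noteq> 0" using Y_square subst.hom_nonzero[OF G_nonzero] by auto
  {
    assume "fst h \<noteq> 0"
    then have "a + b \<noteq> 0" using * by (simp add: subst.fract_lift_eq_0_iff)
    then have "fls_subdegree (a + b) \<ge> - n" using ab fls_plus_subdegree[of a b] by linarith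
    then show "fls_subdegree (fls_lift T (fst h)) \<ge> - n"
      using half[of "a + b"] two[of "fls_lift T (fst h)"] * by simp
  }
  {
    assume "snd h \<noteq> 0"
    then have nz: "fls_lift T (snd h) \<noteq> 0" by (simp add: subst.fract_lift_eq_0_iff)
    with \<open>Y \<noteq> 0\<close> have "a - b \<noteq> 0" using * by simp
    then have "fls_subdegree (a - b) \<ge> - n"
      using ab fls_plus_subdegree[of a "- b"] by (simp add: min_def split: if_splits)
    then show "fls_subdegree (fls_lift T (snd h)) + fls_subdegree Y \<ge> - n"
      using half[of "a - b"] two[of "fls_lift T (snd h) * Y"] * nz \<open>Y \<noteq> 0\<close> by simp
  }
qed

end

lemma fls_subdegree_const_add_power:
  assumes "e > 0"
  shows "fls_subdegree (fls_const c + fls_X ^ e :: 'a::field fls) = (if c = 0 then int e else 0)"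
proof (cases "c = 0")
  case False
  then show ?thesis using assms
    by (intro fls_subdegree_eqI) (auto simp: fls_X_power_nth)
qed (use assms in \<open>simp add: fls_subdegree_pow\<close>)

lemma fls_subdegree_inverse_power_diff_const:
  assumes "e > 0"
  shows "fls_subdegree (fls_X_inv ^ e - fls_const c :: 'a::field fls) = - int e"
  using assms by (intro fls_subdegree_eqI) (auto simp: fls_X_inv_power_nth)

context curve_series
begin

lemma series_place_linear:
  "series_place T Y (Fract [:-x0, 1:] 1, 0) = fls_subdegree (T - fls_const x0)"
  by (simp add: series_place_def ff_series_def fls_lift_poly subst_fls_linear
      subst.lift.hom_zero del: subst_fls_pCons)

lemma fls_subdegree_Fract:
  assumes "p \<noteq> 0" "d \<noteq> 0"
  shows "fls_subdegree (fls_lift T (Fract p d))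
    = fls_subdegree (subst_fls T p) - fls_subdegree (subst_fls T d)"
  using assms by (simp add: subst.fract_lift_Fract subst.hom_nonzero fls_divide_subdegree)

end

section \<open>Expansions at finite points and at infinity\<close>

context curve
begin

text \<open>At a branch point \<open>x - x1\<close> is the square of a local parameter, elsewhere it
  is a local parameter itself; \<open>e\<close> records this ramification.\<close>

lemma finite_series_subdegree:
  fixes x1 :: 'a
  defines "e \<equiv> if poly G x1 = 0 then 2 else 1"
  shows "fls_subdegree (fls_const x1 + fls_X ^ e - fls_const r) = (if r = x1 then int e else 0)"
proof -
  have "e > 0" by (simp add: e_def)
  then show ?thesis
    using fls_subdegree_const_add_power[of e "x1 - r"]
    by (simp add: fls_minus_const[symmetric] algebra_simps split: if_splits)
qed

text \<open>Along \<open>T\<close>, the polynomial \<open>G\<close> has order 2 at a branch point,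
  where its root is simple, and order 0 elsewhere. Both are even, so \<open>y\<close> can be
  expanded as a square root, of order \<open>e - 1\<close>.\<close>

lemma finite_series_exists:
  fixes x1 :: 'a
  defines "e \<equiv> if poly G x1 = 0 then 2 else 1"
  defines "T \<equiv> fls_const x1 + fls_X ^ e"
  obtains Y where "curve_series A g T Y" "fls_subdegree Y = int e - 1"
proof -
  have "e > 0" by (simp add: e_def)
  have sub: "fls_subdegree (T - fls_const r) = (if r = x1 then int e else 0)" for r
    unfolding T_def e_def by (rule finite_series_subdegree)
  have T: "T \<noteq> fls_const r" for r
  proof
    assume "T = fls_const r"
    then have "fls_subdegree (T - fls_const x1) = 0" by (simp add: fls_minus_const)
    then show False using sub[of x1] \<open>e > 0\<close> by simp
  qed
  have "fls_subdegree (subst_fls T G) = int e * int (order x1 G)"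
    by (rule subdegree_subst_fls_finite[OF T _ G_nonzero]) (use sub in auto)
  also have "\<dots> = 2 * (int e - 1)"
    using order_G[of x1] by (auto simp: e_def order_0I)
  finally have *: "fls_subdegree (subst_fls T G) = 2 * (int e - 1)" .
  obtain Y where Y: "Y ^ 2 = subst_fls T G"
    using fls_square_root_exists[OF subst_fls_nonzero[OF T G_nonzero]] * by auto
  have "2 * fls_subdegree Y = 2 * (int e - 1)"
    using * unfolding Y[symmetric] by (simp add: fls_subdegree_pow)
  then show thesis
    using T Y by (intro that[of Y] curve_series.intro curve_series_axioms.intro)
      (simp_all add: curve_axioms)
qed

lemma finite_series_place:
  fixes x1 :: 'a
  defines "e \<equiv> if poly G x1 = 0 then 2 else 1"
  defines "T \<equiv> fls_const x1 + fls_X ^ e"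
  assumes "curve_series A g T Y" "fls_subdegree Y = int e - 1"
  shows "series_place T Y \<in> places A g"
proof -
  interpret curve_series A g T Y by fact
  have "fls_subdegree (fls_lift T (Fract [:-x1, 1:] 1)) = e"
    unfolding fls_lift_poly subst_fls_linear
    using finite_series_subdegree[of x1 x1] unfolding T_def e_def by simp
  then show ?thesis
    using assms(4) by (intro series_place_in_places[of "Fract [:-x1, 1:] 1"]) (auto simp: e_def)
qed

text \<open>For even degree \<open>1 / x\<close> is a local parameter at infinity. For odd degree
  infinity is a branch point and \<open>1 / x\<close> is the square of a parameter, which makes the
  order of \<open>G\<close> even and allows a square root.\<close>

lemma infinite_series_exists:
  fixes e :: nat
  defines "e \<equiv> if even (degree g) then 1 else 2"
  defines "T \<equiv> fls_X_inv ^ e"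
  obtains Y where "curve_series A g T Y" "series_place T Y \<in> places A g"
    "series_place T (- Y) \<in> places A g" "2 * fls_subdegree Y = - int e * int (degree G)"
proof -
  have "e > 0" by (simp add: e_def)
  have sub: "fls_subdegree (T - fls_const r) = - int e" for r
    unfolding T_def by (rule fls_subdegree_inverse_power_diff_const[OF \<open>e > 0\<close>])
  have T: "T \<noteq> fls_const r" for r
  proof
    assume "T = fls_const r"
    then have "fls_subdegree (T - fls_const r) = 0" by simp
    then show False using sub[of r] \<open>e > 0\<close> by simp
  qed
  have *: "fls_subdegree (subst_fls T G) = - int e * int (degree G)"
    by (rule subdegree_subst_fls_infinite[OF T _ G_nonzero]) (use sub in auto)
  have "even (fls_subdegree (subst_fls T G))" unfolding * degree_G by (simp add: e_def)
  then obtain Y where Y: "Y ^ 2 = subst_fls T G"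
    using fls_square_root_exists[OF subst_fls_nonzero[OF T G_nonzero]] by auto
  have deg: "2 * fls_subdegree Y = - int e * int (degree G)"
    using * unfolding Y[symmetric] by (simp add: fls_subdegree_pow)
  interpret curve_series A g T Y
    using T Y by (intro curve_series.intro curve_series_axioms.intro) (simp_all add: curve_axioms)
  interpret neg: curve_series A g T "- Y" by (rule curve_series_minus)
  define R :: "'a poly fract" where "R = Fract 1 [:0, 1:]"
  have "fls_subdegree (fls_lift T R) = e"
    using sub[of 0] fls_subdegree_Fract[of 1 "[:0, 1:]"]
    by (simp add: R_def subst.hom_one subst_fls_pCons)
  \<comment> \<open>If \<open>e = 2\<close>, the order of \<open>Y\<close> is minus the degree of
    \<open>G\<close>, which is odd in this case.\<close>
  moreover have "e = 1 \<or> e = 2 \<and> odd (fls_subdegree Y)"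
    using deg by (auto simp: e_def degree_G)
  ultimately have "fls_subdegree (fls_lift T R) = 1
      \<or> fls_subdegree (fls_lift T R) = 2 \<and> odd (fls_subdegree Y)"
    by auto
  then have "series_place T Y \<in> places A g" "series_place T (- Y) \<in> places A g"
    by (auto intro!: series_place_in_places neg.series_place_in_places)
  then show thesis using that curve_series_axioms deg by blast
qed

text \<open>A function with divisor \<open>n (P - P')\<close> has its only pole at
  \<open>P'\<close>. Hence the denominators of its components divide \<open>(x - x0) ^ n\<close>,
  and regularity at infinity bounds the numerators. Multiplication by \<open>(x - x0) ^ n\<close>,
  of order \<open>n\<close> at \<open>P\<close>, doubles the order there.\<close>

lemma divisor_polynomials:
  fixes x0 :: 'a
  defines "T \<equiv> fls_const x0 + fls_X"
  assumes G0: "poly G x0 \<noteq> 0" and cs: "curve_series A g T Y"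
    and "n > 0" "h \<noteq> 0"
    and v: "series_place T Y h = int n" "series_place T (- Y) h = - int n"
    and others: "\<And>v. v \<in> places A g \<Longrightarrow> v \<noteq> series_place T Y \<Longrightarrow> v \<noteq> series_place T (- Y)
      \<Longrightarrow> v h = 0"
  obtains p q where "q \<noteq> 0" "degree p \<le> n" "2 * degree q + degree G \<le> 2 * n"
    "fls_subdegree (subst_fls T p + subst_fls T q * Y) = 2 * int n"
proof -
  interpret P: curve_series A g T Y by fact
  interpret P': curve_series A g T "- Y" by (rule P.curve_series_minus)
  define L where "L = [:-x0, 1:]"
  have L: "L \<noteq> 0" by (simp add: L_def)
  have T_sub: "fls_subdegree (T - fls_const r) = (if r = x0 then 1 else 0)" for r
    using finite_series_subdegree[of x0 r] G0 by (simp add: T_def)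
  \<comment> \<open>The function \<open>x - x0\<close> has order 1 at \<open>P\<close> and at
    \<open>P'\<close>; any other value rules these two places out.\<close>
  have others': "v h = 0" if "v \<in> places A g" "v (Fract L 1, 0) \<noteq> 1" for v
  proof -
    have "series_place T Y (Fract L 1, 0) = 1" "series_place T (- Y) (Fract L 1, 0) = 1"
      using T_sub[of x0] unfolding L_def P.series_place_linear P'.series_place_linear by auto
    then show ?thesis using that others by metis
  qed
  have finite_bounds:
    "fst h = Fract p d \<Longrightarrow> order x1 d \<le> order x1 p + (if x1 = x0 then n else 0)"
    "snd h = Fract p d \<Longrightarrow> order x1 d \<le> order x1 p + (if x1 = x0 then n else 0)"
    if pd: "d \<noteq> 0" "p \<noteq> 0" for p d x1
  proof -
    have *: "(fst h = Fract p d \<longrightarrow> order x1 d \<le> order x1 p + m) \<and>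
        (snd h = Fract p d \<longrightarrow> order x1 d \<le> order x1 p + m)"
      if S: "curve_series A g S Z" "series_place S Z h \<ge> - int m" "series_place S (- Z) h \<ge> - int m"
        "\<And>r. fls_subdegree (S - fls_const r) = (if r = x1 then int e else 0)"
        "e = 1 \<and> fls_subdegree Z = 0 \<or> e = 2 \<and> fls_subdegree Z = 1 \<and> m = 0" for S Z m e
    proof -
      interpret S: curve_series A g S Z by fact
      have nz: "Fract p d \<noteq> 0" using pd by (simp add: Zero_fract_def eq_fract)
      have sub: "fls_subdegree (fls_lift S (Fract p d)) = int e * (int (order x1 p) - int (order x1 d))"
        using subdegree_subst_fls_finite[OF S.T_nonconst S(4)] pd
        by (simp add: S.fls_subdegree_Fract right_diff_distrib)
      have "order x1 d \<le> order x1 p + m" if "fst h = Fract p d"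
        using S.components_subdegree_ge(1)[OF S(2,3) \<open>h \<noteq> 0\<close>] nz sub S(5) that by auto
      moreover have "order x1 d \<le> order x1 p + m" if "snd h = Fract p d"
        using S.components_subdegree_ge(2)[OF S(2,3) \<open>h \<noteq> 0\<close>] nz sub S(5) that by auto
      ultimately show ?thesis by blast
    qed
    have "(fst h = Fract p d \<longrightarrow> order x1 d \<le> order x1 p + (if x1 = x0 then n else 0)) \<and>
        (snd h = Fract p d \<longrightarrow> order x1 d \<le> order x1 p + (if x1 = x0 then n else 0))"
    proof (cases "x1 = x0")
      case True
      have "2 * fls_subdegree Y = fls_subdegree (subst_fls T G)"
        unfolding P.Y_square[symmetric] by (simp add: fls_subdegree_pow)
      also have "\<dots> = 0"
        using subdegree_subst_fls_finite[OF P.T_nonconst T_sub G_nonzero] G0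
        by (simp add: order_0I)
      finally show ?thesis
        using *[OF cs, of n 1] v T_sub True by simp
    next
      case False
      define e :: nat where "e = (if poly G x1 = 0 then 2 else 1)"
      define S where "S = fls_const x1 + fls_X ^ e"
      obtain Z where Z: "curve_series A g S Z" "fls_subdegree Z = int e - 1"
        using finite_series_exists[of x1] unfolding S_def e_def by blast
      interpret S: curve_series A g S Z by fact
      interpret S': curve_series A g S "- Z" by (rule S.curve_series_minus)
      have S_sub: "fls_subdegree (S - fls_const r) = (if r = x1 then int e else 0)" for r
        unfolding S_def e_def by (rule finite_series_subdegree)
      have "series_place S Z \<in> places A g" "series_place S (- Z) \<in> places A g"
        using finite_series_place[of x1] Z S.curve_series_minus unfolding S_def e_def by auto
      then have "series_place S Z h = 0" "series_place S (- Z) h = 0"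
        using False others' S.series_place_linear[of x0] S'.series_place_linear[of x0] S_sub[of x0]
        unfolding L_def by auto
      then show ?thesis
        using *[OF Z(1), of 0 e] S_sub False Z(2) by (auto simp: e_def)
    qed
    then show
      "fst h = Fract p d \<Longrightarrow> order x1 d \<le> order x1 p + (if x1 = x0 then n else 0)"
      "snd h = Fract p d \<Longrightarrow> order x1 d \<le> order x1 p + (if x1 = x0 then n else 0)"
      by blast+
  qed
  obtain p where p: "fst h = Fract p (L ^ n)"
    using Fract_power_denominator[of "fst h" x0 n] finite_bounds(1) unfolding L_def by metis
  obtain q where q: "snd h = Fract q (L ^ n)"
    using Fract_power_denominator[of "snd h" x0 n] finite_bounds(2) unfolding L_def by metis
  \<comment> \<open>Otherwise \<open>h\<close> would be a function of \<open>x\<close> alone and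
    would have equal orders at conjugate places.\<close>
  have "q \<noteq> 0"
  proof
    assume "q = 0"
    then have "snd h = 0" using q L by (simp add: Zero_fract_def eq_fract)
    then have "series_place T Y h = series_place T (- Y) h"
      by (simp add: series_place_def ff_series_def P.subst.lift.hom_zero)
    then show False using v \<open>n > 0\<close> by simp
  qed
  \<comment> \<open>At infinity \<open>x - x0\<close> has a pole, so \<open>h\<close> has order 0
    there; this gives the degree bounds.\<close>
  define e :: nat where "e = (if even (degree g) then 1 else 2)"
  define S :: "'a fls" where "S = fls_X_inv ^ e"
  obtain Z where Z: "curve_series A g S Z" "series_place S Z \<in> places A g"
    "series_place S (- Z) \<in> places A g" "2 * fls_subdegree Z = - int e * int (degree G)"
    using infinite_series_exists unfolding S_def e_def by blast
  interpret S: curve_series A g S Z by fact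
  interpret S': curve_series A g S "- Z" by (rule S.curve_series_minus)
  have "e > 0" by (simp add: e_def)
  have S_sub: "fls_subdegree (S - fls_const r) = - int e" for r
    unfolding S_def by (rule fls_subdegree_inverse_power_diff_const[OF \<open>e > 0\<close>])
  have "series_place S Z h = 0" "series_place S (- Z) h = 0"
    using Z(2,3) others' S.series_place_linear[of x0] S'.series_place_linear[of x0] S_sub[of x0]
    unfolding L_def by auto
  then have S0: "series_place S Z h \<ge> - 0" "series_place S (- Z) h \<ge> - 0" by auto
  have sub: "fls_subdegree (fls_lift S (Fract r (L ^ n))) = int e * (int n - int (degree r))"
    if "r \<noteq> 0" for r
  proof -
    have "degree (L ^ n) = n" by (simp add: L_def degree_linear_power)
    then show ?thesis
      using subdegree_subst_fls_infinite[OF S.T_nonconst S_sub] that L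
      by (simp add: S.fls_subdegree_Fract right_diff_distrib)
  qed
  have "degree p \<le> n"
  proof (cases "p = 0")
    case False
    then have "fst h \<noteq> 0" using p L by (simp add: Zero_fract_def eq_fract)
    then have "int e * (int n - int (degree p)) \<ge> 0"
      using S.components_subdegree_ge(1)[OF S0 \<open>h \<noteq> 0\<close>] sub[OF False] p by simp
    then show ?thesis using \<open>e > 0\<close> by (simp add: zero_le_mult_iff)
  qed auto
  moreover have "2 * degree q + degree G \<le> 2 * n"
  proof -
    have "snd h \<noteq> 0" using q L \<open>q \<noteq> 0\<close> by (simp add: Zero_fract_def eq_fract)
    then have "int e * (int n - int (degree q)) + fls_subdegree Z \<ge> 0"
      using S.components_subdegree_ge(2)[OF S0 \<open>h \<noteq> 0\<close>] sub[OF \<open>q \<noteq> 0\<close>] q by simp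
    \<comment> \<open>Doubling clears the half in the order \<open>- e * degree G / 2\<close> of
      \<open>y\<close> at infinity.\<close>
    then have "int e * (2 * int n - 2 * int (degree q) - int (degree G)) \<ge> 0"
      using Z(4) by (simp add: algebra_simps)
    then show ?thesis using \<open>e > 0\<close> by (simp add: zero_le_mult_iff)
  qed
  moreover have "fls_subdegree (subst_fls T p + subst_fls T q * Y) = 2 * int n"
  proof -
    have Ln: "subst_fls T (L ^ n) \<noteq> 0" using L P.subst.hom_nonzero by simp
    have "ff_series T Y h * subst_fls T (L ^ n) = subst_fls T p + subst_fls T q * Y"
      using Ln L by (simp add: ff_series_def p q P.subst.fract_lift_Fract distrib_right)
    moreover have "fls_subdegree (subst_fls T (L ^ n)) = int n"
      unfolding P.subst.hom_power L_def subst_fls_linear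
      by (simp add: fls_subdegree_pow T_sub)
    ultimately show ?thesis
      using v(1) P.ff_series_nonzero[OF \<open>h \<noteq> 0\<close>] Ln
      by (metis fls_subdegree_mult mult_2 series_place_def)
  qed
  ultimately show thesis using that \<open>q \<noteq> 0\<close> by blast
qed

end

subsection \<open>A rational point and its Pell equation\<close>

text \<open>Hensel lifting. The approximations to \<open>y\<close> are polynomials over the base
  field, which is what the later descent from the algebraic closure requires.\<close>

lemma hensel_square_root:
  fixes G :: "'k::field_char_0 poly"
  assumes "poly G x0 = y0 ^ 2" "y0 \<noteq> 0"
  shows "\<exists>Y. poly Y x0 = y0 \<and> [:-x0, 1:] ^ Suc n dvd Y ^ 2 - G"
proof (induction n)
  case 0
  show ?case by (rule exI[of _ "[:y0:]"]) (simp add: assms flip: poly_eq_0_iff_dvd)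
next
  case (Suc n)
  define L where "L = [:-x0, 1:]"
  obtain Y where Y: "poly Y x0 = y0" and "L ^ Suc n dvd Y ^ 2 - G"
    using Suc unfolding L_def by blast
  then obtain r where r: "Y ^ 2 - G = L ^ Suc n * r" by (elim dvdE)
  \<comment> \<open>This solves \<open>poly r x0 + 2 * c * y0 = 0\<close>, so that one more factor
    \<open>L\<close> can be split off.\<close>
  define c where "c = - poly r x0 / (2 * y0)"
  define Y' where "Y' = Y + L ^ Suc n * [:c:]"
  have "poly (r + 2 * [:c:] * Y + [:c:] ^ 2 * L ^ Suc n) x0 = 0"
    using assms(2) by (simp add: Y c_def L_def)
  then have "L dvd r + 2 * [:c:] * Y + [:c:] ^ 2 * L ^ Suc n"
    unfolding L_def poly_eq_0_iff_dvd .
  then have "L ^ Suc n * L dvd L ^ Suc n * (r + 2 * [:c:] * Y + [:c:] ^ 2 * L ^ Suc n)"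
    by (rule mult_dvd_mono[OF dvd_refl])
  also have "L ^ Suc n * (r + 2 * [:c:] * Y + [:c:] ^ 2 * L ^ Suc n) = Y' ^ 2 - G"
  proof -
    have "M * (r + 2 * C * Y + C ^ 2 * M) = (Y + M * C) ^ 2 - G" if "Y ^ 2 - G = M * r" for M C
      using that by (simp add: power2_eq_square algebra_simps)
    then show ?thesis using r unfolding Y'_def by blast
  qed
  finally have "L ^ Suc (Suc n) dvd Y' ^ 2 - G" by (simp add: mult.commute)
  moreover have "poly Y' x0 = y0" by (simp add: Y'_def Y L_def)
  ultimately show ?case unfolding L_def by blast
qed

text \<open>A non-zero \<open>b\<close> is linearly independent in the closure, seen as a vector
  space over the base field, so a linear functional can be prescribed on it.\<close>

lemma alg_closure_functional_exists:
  fixes b :: "'k::field alg_closure"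
  assumes "b \<noteq> 0"
  shows "\<exists>\<phi> :: 'k alg_closure \<Rightarrow> 'k. (\<forall>x y. \<phi> (x + y) = \<phi> x + \<phi> y) \<and>
    (\<forall>c x. \<phi> (to_ac c * x) = c * \<phi> x) \<and> \<phi> b = 1"
proof -
  interpret vector_space_pair "\<lambda>(c::'k) (x::'k alg_closure). to_ac c * x" "(*) :: 'k \<Rightarrow> _"
    by unfold_locales (simp_all add: algebra_simps)
  have "vs1.independent {b}"
    using assms by (simp add: vs1.dependent_single)
  then obtain \<phi> where \<phi>: "Vector_Spaces.linear (\<lambda>c x. to_ac c * x) (*) \<phi>" "\<phi> b = 1"
    using linear_independent_extend[of "{b}" "\<lambda>_. 1"] by auto
  interpret Vector_Spaces.linear "\<lambda>c x. to_ac c * x" "(*)" \<phi> by fact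
  show ?thesis using \<phi>(2) add scale by blast
qed

lemma ring_morphism_to_ac: "ring_morphism (to_ac :: 'k::field \<Rightarrow> _)"
  by unfold_locales simp_all

text \<open>A functional that is linear over the base field, applied to coefficients, respects
  products with polynomials over that field and does not raise degrees. Normalised to 1 at the
  leading coefficient of \<open>q\<close>, it keeps the image of \<open>q\<close> non-zero.\<close>

lemma descend_linear_relation:
  fixes L Y :: "'k::field poly"
  assumes "map_poly to_ac L dvd p + q * map_poly to_ac Y" "q \<noteq> 0"
  obtains p' q' where "q' \<noteq> 0" "degree p' \<le> degree p" "degree q' \<le> degree q" "L dvd p' + q' * Y"
proof -
  have "lead_coeff q \<noteq> 0" using assms(2) by simp
  then obtain \<phi> :: "'k alg_closure \<Rightarrow> 'k"
    where \<phi>: "\<And>x y. \<phi> (x + y) = \<phi> x + \<phi> y" "\<And>c x. \<phi> (to_ac c * x) = c * \<phi> x"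
      "\<phi> (lead_coeff q) = 1"
    using alg_closure_functional_exists by metis
  have \<phi>0: "\<phi> 0 = 0" using \<phi>(2)[of 0 0] by simp
  define \<Phi> where "\<Phi> = map_poly \<phi>"
  have add: "\<Phi> (a + b) = \<Phi> a + \<Phi> b" for a b
    unfolding \<Phi>_def by (intro poly_eqI) (simp add: coeff_map_poly \<phi> \<phi>0)
  have mult: "\<Phi> (map_poly to_ac a * b) = a * \<Phi> b" for a b
  proof (induction a)
    case 0
    then show ?case by (simp add: \<Phi>_def)
  next
    case (pCons c a)
    have "\<Phi> (smult (to_ac c) b) = smult c (\<Phi> b)"
      unfolding \<Phi>_def by (intro poly_eqI) (simp add: coeff_map_poly \<phi> \<phi>0)
    moreover have "\<Phi> (pCons 0 b') = pCons 0 (\<Phi> b')" for b'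
      unfolding \<Phi>_def by (simp add: map_poly_pCons \<phi>0)
    ultimately show ?case using pCons by (simp add: map_poly_pCons add)
  qed
  have deg: "degree (\<Phi> a) \<le> degree a" for a
    unfolding \<Phi>_def by (rule degree_le) (simp add: coeff_map_poly \<phi>0 coeff_eq_0)
  obtain s where "p + q * map_poly to_ac Y = map_poly to_ac L * s" using assms(1) by (elim dvdE)
  then have "\<Phi> p + \<Phi> q * Y = L * \<Phi> s"
    using add[of p "map_poly to_ac Y * q"] by (simp add: mult mult.commute[of _ Y] mult.commute[of q])
  moreover have "coeff (\<Phi> q) (degree q) = 1"
    unfolding \<Phi>_def by (simp add: coeff_map_poly \<phi>0 \<phi>(3))
  then have "\<Phi> q \<noteq> 0" by auto
  ultimately show thesis using that[of "\<Phi> q" "\<Phi> p"] deg by (metis dvd_triv_left)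
qed

lemma subst_fls_nth_0:
  fixes p :: "'a::alg_closed_field poly"
  shows "subst_fls (fls_const x0 + fls_X) p $$ 0 = poly p x0"
proof -
  have neg: "subst_fls (fls_const x0 + fls_X) p $$ n = 0" if "n < 0" for n and p :: "'a poly"
    using that
  proof (induction p arbitrary: n)
    case (pCons a p)
    then show ?case by (simp add: subst_fls_pCons distrib_right fls_X_times_conv_shift)
  qed simp
  show ?thesis
    by (induction p) (simp_all add: subst_fls_pCons distrib_right fls_X_times_conv_shift neg)
qed

text \<open>As \<open>y0\<close> is non-zero, the point is not a branch point: it differs from its
  conjugate, and \<open>x - x0\<close> is a local parameter at both.\<close>

locale rational_point =
  fixes A :: "'k::field_char_0" and g :: "'k poly" and x0 y0 :: 'k
  assumes A_nonzero: "A \<noteq> 0"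
    and simple_roots: "poly (map_poly to_ac g) x = 0 \<Longrightarrow> poly (pderiv (map_poly to_ac g)) x \<noteq> 0"
    and degree_g: "degree g \<ge> 3"
    and on_curve: "A * y0 ^ 2 = poly g x0"
    and y0_nonzero: "y0 \<noteq> 0"
begin

definition H :: "'k poly" where "H = smult (inverse A) g"

lemma poly_H: "poly H x0 = y0 ^ 2"
  using on_curve[symmetric] A_nonzero by (simp add: H_def)

sublocale ac: ring_morphism "to_ac :: 'k \<Rightarrow> _" by (rule ring_morphism_to_ac)

sublocale ac_poly: ring_morphism "map_poly (to_ac :: 'k \<Rightarrow> _)"
  by (rule ac.ring_morphism_map_poly)

sublocale curve "to_ac A" "map_poly to_ac g"
  by unfold_locales (use A_nonzero simple_roots degree_g in \<open>auto simp: degree_map_poly\<close>)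

lemma G_eq: "G = map_poly to_ac H"
  by (simp add: G_def H_def map_poly_smult)

lemma poly_G_x0: "poly G (to_ac x0) = to_ac y0 ^ 2"
  by (simp add: G_eq ac.poly_hom poly_H)

definition T :: "'k alg_closure fls" where "T = fls_const (to_ac x0) + fls_X"

text \<open>The two square roots of \<open>G(T)\<close> differ by sign; the value of
  \<open>y\<close> at the point selects one of them.\<close>

lemma local_series_exists: "\<exists>Y. curve_series (to_ac A) (map_poly to_ac g) T Y \<and> Y $$ 0 = to_ac y0"
proof -
  have nz: "poly G (to_ac x0) \<noteq> 0" using poly_G_x0 y0_nonzero by simp
  obtain Y where Y: "curve_series (to_ac A) (map_poly to_ac g) T Y" "fls_subdegree Y = 0"
    using finite_series_exists[of "to_ac x0"] nz unfolding T_def by auto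
  interpret Y: curve_series "to_ac A" "map_poly to_ac g" T Y by fact
  have "(Y ^ 2) $$ 0 = to_ac y0 ^ 2"
    unfolding Y.Y_square T_def subst_fls_nth_0 by (rule poly_G_x0)
  then have "(Y $$ 0) ^ 2 = to_ac y0 ^ 2"
    using fls_times_base[of Y Y] Y(2) by (simp add: power2_eq_square)
  then have "Y $$ 0 = to_ac y0 \<or> (- Y) $$ 0 = to_ac y0"
    by (auto simp: power2_eq_iff)
  then show ?thesis using Y(1) Y.curve_series_minus by blast
qed

definition Y :: "'k alg_closure fls" where
  "Y = (SOME Y. curve_series (to_ac A) (map_poly to_ac g) T Y \<and> Y $$ 0 = to_ac y0)"

sublocale P: curve_series "to_ac A" "map_poly to_ac g" T Y
  using someI_ex[OF local_series_exists] unfolding Y_def by blast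

lemma Y_nth_0: "Y $$ 0 = to_ac y0"
  using someI_ex[OF local_series_exists] unfolding Y_def by blast

sublocale P': curve_series "to_ac A" "map_poly to_ac g" T "- Y"
  by (rule P.curve_series_minus)

lemma fls_subdegree_T: "fls_subdegree (T - fls_const r) = (if r = to_ac x0 then 1 else 0)"
  using finite_series_subdegree[of "to_ac x0" r] poly_G_x0 y0_nonzero by (simp add: T_def)

lemma fls_subdegree_subst: "p \<noteq> 0 \<Longrightarrow> fls_subdegree (subst_fls T p) = int (order (to_ac x0) p)"
  using subdegree_subst_fls_finite[OF P.T_nonconst, of "to_ac x0" 1] fls_subdegree_T by simp

lemma fls_subdegree_Y: "fls_subdegree Y = 0"
proof -
  have "2 * fls_subdegree Y = fls_subdegree (subst_fls T G)"
    unfolding P.Y_square[symmetric] by (simp add: fls_subdegree_pow)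
  also have "\<dots> = 0"
    using poly_G_x0 y0_nonzero by (simp add: fls_subdegree_subst G_nonzero order_0I)
  finally show ?thesis by simp
qed

lemma places_P: "series_place T Y \<in> places (to_ac A) (map_poly to_ac g)"
  "series_place T (- Y) \<in> places (to_ac A) (map_poly to_ac g)"
proof -
  have "poly G (to_ac x0) \<noteq> 0" using poly_G_x0 y0_nonzero by simp
  then show "series_place T Y \<in> places (to_ac A) (map_poly to_ac g)"
    "series_place T (- Y) \<in> places (to_ac A) (map_poly to_ac g)"
    using finite_series_place[of "to_ac x0"] fls_subdegree_Y P.curve_series_axioms
      P'.curve_series_axioms by (auto simp: T_def)
qed

text \<open>The function \<open>y - y0\<close> vanishes at the point, but takes the non-zero value
  \<open>- 2 * y0\<close> at the conjugate point.\<close>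

lemma places_P_distinct: "series_place T Y \<noteq> series_place T (- Y)"
proof -
  define h :: "'k alg_closure ff_elem" where "h = (Fract [:- to_ac y0:] 1, 1)"
  have "h \<noteq> 0" by (simp add: h_def zero_prod_def)
  have h: "ff_series T Y h = Y - fls_const (to_ac y0)"
    "ff_series T (- Y) h = - Y - fls_const (to_ac y0)"
    by (simp_all add: ff_series_def h_def P.fls_lift_poly subst_fls_pCons P.subst.lift.hom_one)
  have "fls_subdegree (Y - fls_const (to_ac y0)) > 0"
  proof (rule fls_subdegree_greaterI)
    show "Y - fls_const (to_ac y0) \<noteq> 0" using P.ff_series_nonzero[OF \<open>h \<noteq> 0\<close>] h by simp
    show "(Y - fls_const (to_ac y0)) $$ k = 0" if "k \<le> 0" for k
      using that Y_nth_0 fls_subdegree_Y by (cases "k = 0") auto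
  qed
  moreover have "fls_subdegree (- Y - fls_const (to_ac y0)) \<le> 0"
  proof (rule fls_subdegree_leI)
    have "- to_ac y0 - to_ac y0 = - (2 * to_ac y0)" by simp
    also have "\<dots> \<noteq> 0" using y0_nonzero by simp
    finally show "(- Y - fls_const (to_ac y0)) $$ 0 \<noteq> 0" using Y_nth_0 by simp
  qed
  ultimately have "series_place T Y h \<noteq> series_place T (- Y) h"
    by (simp add: series_place_def h)
  then show ?thesis by auto
qed

text \<open>With \<open>y\<close> replaced by a polynomial approximation over the base field, the
  high order of \<open>p + q y\<close> at \<open>P\<close> becomes a linear divisibility condition,
  which descends. The norm of the descended function is divisible by
  \<open>(x - x0) ^ (2 * n)\<close> and has degree at most \<open>2 * n\<close>.\<close>

lemma conjugate_divisor_imp_pell: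
  assumes "n > 0" "h \<noteq> 0"
    and "series_place T Y h = int n" "series_place T (- Y) h = - int n"
    and "\<And>v. v \<in> places (to_ac A) (map_poly to_ac g) \<Longrightarrow> v \<noteq> series_place T Y \<Longrightarrow>
      v \<noteq> series_place T (- Y) \<Longrightarrow> v h = 0"
  obtains p q c where "q \<noteq> 0" "degree p \<le> n" "2 * degree q + degree H \<le> 2 * n" "c \<noteq> 0"
    "p ^ 2 - q ^ 2 * H = [:c:] * [:-x0, 1:] ^ (2 * n)"
proof -
  have deg_H: "degree G = degree H" by (simp add: G_eq degree_map_poly)
  obtain p q where pq: "q \<noteq> 0" "degree p \<le> n" "2 * degree q + degree G \<le> 2 * n"
    "fls_subdegree (subst_fls T p + subst_fls T q * Y) = 2 * int n"
  proof (rule divisor_polynomials[of "to_ac x0" Y n h, folded T_def])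
    show "poly G (to_ac x0) \<noteq> 0" using poly_G_x0 y0_nonzero by simp
    show "curve_series (to_ac A) (map_poly to_ac g) T Y" by (rule P.curve_series_axioms)
  qed (use assms in blast)+
  define L where "L = [:-x0, 1:]"
  have mL: "map_poly to_ac L = [:- to_ac x0, 1:]" by (simp add: L_def map_poly_pCons)
  obtain R where R: "poly R x0 = y0" "L ^ Suc (2 * n) dvd R ^ 2 - H"
    using hensel_square_root[OF poly_H y0_nonzero] unfolding L_def by blast
  then have dvd: "L ^ (2 * n) dvd R ^ 2 - H" by (meson dvd_trans le_imp_power_dvd lessI less_imp_le)
  define S where "S = subst_fls T (map_poly to_ac R)"
  have subst_ge: "subst_fls T a = 0 \<or> fls_subdegree (subst_fls T a) \<ge> int m
      \<longleftrightarrow> map_poly to_ac (L ^ m) dvd a" for a m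
    unfolding ac_poly.hom_power mL
    by (cases "a = 0") (auto simp: P.subst.hom_nonzero fls_subdegree_subst order_divides)
  \<comment> \<open>The product \<open>(S - Y) * (S + Y)\<close> has high order or vanishes, and
    \<open>S + Y\<close> has the non-zero constant term \<open>2 * y0\<close>; so the first factor
    carries the whole order.\<close>
  have "S - Y = 0 \<or> fls_subdegree (S - Y) \<ge> 2 * int n"
  proof -
    have "map_poly to_ac (L ^ (2 * n)) dvd map_poly to_ac R ^ 2 - G"
      using dvd ac_poly.hom_mult unfolding dvd_def
      by (metis G_eq ac_poly.hom_diff ac_poly.hom_power)
    then have "subst_fls T (map_poly to_ac R ^ 2 - G) = 0
        \<or> fls_subdegree (subst_fls T (map_poly to_ac R ^ 2 - G)) \<ge> int (2 * n)"
      using subst_ge by blast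
    moreover have "subst_fls T (map_poly to_ac R ^ 2 - G) = (S - Y) * (S + Y)"
      by (simp add: P.subst.hom_diff P.subst.hom_power S_def flip: P.Y_square)
        (simp add: power2_eq_square algebra_simps)
    moreover have "(S + Y) $$ 0 = 2 * to_ac y0"
      unfolding S_def T_def by (simp add: subst_fls_nth_0 Y_nth_0 ac.poly_hom R(1))
    then have "(S + Y) $$ 0 \<noteq> 0" using y0_nonzero by (simp del: fls_plus_nth)
    then have "S + Y \<noteq> 0" "fls_subdegree (S + Y) \<le> 0"
      using fls_subdegree_leI by (auto simp del: fls_plus_nth)
    ultimately show ?thesis by (cases "S - Y = 0") auto
  qed
  moreover have "subst_fls T q * Y + subst_fls T q * (S - Y) = subst_fls T (q * map_poly to_ac R)"
    by (simp add: P.subst.hom_mult S_def algebra_simps)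
  then have eq: "subst_fls T (p + q * map_poly to_ac R)
      = (subst_fls T p + subst_fls T q * Y) + subst_fls T q * (S - Y)"
    by (simp add: P.subst.hom_add)
  moreover have "fls_subdegree (subst_fls T q) \<ge> 0" "subst_fls T q \<noteq> 0"
    using fls_subdegree_subst[OF pq(1)] P.subst.hom_nonzero[OF pq(1)] by simp_all
  ultimately have "subst_fls T (p + q * map_poly to_ac R) = 0
      \<or> fls_subdegree (subst_fls T (p + q * map_poly to_ac R)) \<ge> int (2 * n)"
    using pq(4) fls_plus_subdegree[of "subst_fls T p + subst_fls T q * Y" "subst_fls T q * (S - Y)"]
    by (cases "S - Y = 0") auto
  then have "map_poly to_ac (L ^ (2 * n)) dvd p + q * map_poly to_ac R" using subst_ge by blast
  then obtain p' q' where pq': "q' \<noteq> 0" "degree p' \<le> degree p" "degree q' \<le> degree q"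
    "L ^ (2 * n) dvd p' + q' * R"
    using descend_linear_relation pq(1) by blast
  \<comment> \<open>The first summand is divisible by \<open>L ^ (2 * n)\<close> by descent, the
    second because \<open>R\<close> approximates a square root of \<open>H\<close>.\<close>
  have "p' ^ 2 - q' ^ 2 * H = (p' + q' * R) * (p' - q' * R) + q' ^ 2 * (R ^ 2 - H)"
    by (simp add: power2_eq_square algebra_simps)
  then have "L ^ (2 * n) dvd p' ^ 2 - q' ^ 2 * H"
    using pq'(4) dvd by simp
  then obtain r where r: "p' ^ 2 - q' ^ 2 * H = L ^ (2 * n) * r" by (elim dvdE)
  \<comment> \<open>The norm does not vanish because \<open>H\<close> is not a square of a rational
    function, even over the algebraic closure.\<close>
  have nz: "p' ^ 2 - q' ^ 2 * H \<noteq> 0"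
  proof
    assume "p' ^ 2 - q' ^ 2 * H = 0"
    then have "map_poly to_ac p' ^ 2 = map_poly to_ac q' ^ 2 * G"
      by (simp add: G_eq flip: ac_poly.hom_power ac_poly.hom_mult)
    then have "map_poly to_ac q' = 0" by (rule G_not_square)
    then show False using pq'(1) by (simp add: map_poly_eq_0_iff)
  qed
  have "degree (p' ^ 2 - q' ^ 2 * H) \<le> 2 * n"
    using pq' pq deg_H
    by (intro degree_diff_le order_trans[OF degree_power_le] order_trans[OF degree_mult_le]
        order_trans[OF add_mono[OF degree_power_le order_refl]]) auto
  moreover have "r \<noteq> 0" "L \<noteq> 0" using nz r by (auto simp: L_def)
  then have "degree (p' ^ 2 - q' ^ 2 * H) = 2 * n + degree r"
    unfolding r by (simp add: degree_mult_eq degree_power_eq) (simp add: L_def)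
  ultimately have "degree r = 0" by simp
  then obtain c where "r = [:c:]" by (metis degree_eq_zeroE)
  with r \<open>r \<noteq> 0\<close> have "p' ^ 2 - q' ^ 2 * H = [:c:] * L ^ (2 * n)" "c \<noteq> 0" by auto
  then show thesis using that[of q' p' c] pq pq' deg_H unfolding L_def by simp
qed

end

subsection \<open>Galois action\<close>

lemma map_ratfun_eq_fract_lift: "map_ratfun \<sigma> = fract_lift (\<lambda>p. Fract (map_poly \<sigma> p) 1)"
  unfolding map_ratfun_def fract_lift_def by (intro ext) simp

lemma fract_morphism_map_poly:
  fixes \<sigma> :: "'a::field \<Rightarrow> 'a"
  assumes "ring_morphism \<sigma>" "\<And>x. \<sigma> x = 0 \<Longrightarrow> x = 0"
  shows "fract_morphism (\<lambda>p. Fract (map_poly \<sigma> p) 1)"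
proof -
  interpret ring_morphism \<sigma> by fact
  interpret m: ring_morphism "map_poly \<sigma>" by (rule ring_morphism_map_poly)
  show ?thesis
  proof
    show "Fract (map_poly \<sigma> p) 1 \<noteq> 0" if "p \<noteq> 0" for p
      using that assms(2) hom_zero map_poly_eq_0_iff[of \<sigma> p]
      by (auto simp: Zero_fract_def eq_fract)
  qed (simp_all add: m.hom_simps One_fract_def)
qed

definition ff_map :: "('a::field \<Rightarrow> 'a) \<Rightarrow> 'a ff_elem \<Rightarrow> 'a ff_elem" where
  "ff_map \<sigma> h = (map_ratfun \<sigma> (fst h), map_ratfun \<sigma> (snd h))"

lemma galois_place_eq: "galois_place \<sigma> v h = v (ff_map (inv_into UNIV \<sigma>) h)"
  by (cases h) (simp add: galois_place_def ff_map_def)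

lemma galois_group_morphism:
  assumes "\<sigma> \<in> galois_group"
  shows "ring_morphism \<sigma>" "\<sigma> x = 0 \<longleftrightarrow> x = 0" "\<sigma> (to_ac c) = to_ac c"
proof -
  have \<sigma>: "bij \<sigma>" "\<And>x y. \<sigma> (x + y) = \<sigma> x + \<sigma> y" "\<And>x y. \<sigma> (x * y) = \<sigma> x * \<sigma> y"
    "\<And>c. \<sigma> (to_ac c) = to_ac c"
    using assms unfolding galois_group_def by auto
  show "ring_morphism \<sigma>"
    by unfold_locales (use \<sigma>(2,3) \<sigma>(4)[of 1] in auto)
  show "\<sigma> x = 0 \<longleftrightarrow> x = 0"
    using \<sigma>(1) \<sigma>(4)[of 0] by (metis bij_is_inj injD to_ac_0)
  show "\<sigma> (to_ac c) = to_ac c" by (rule \<sigma>(4))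
qed

lemma galois_group_inv:
  assumes "\<sigma> \<in> galois_group"
  shows "inv_into UNIV \<sigma> \<in> galois_group"
proof -
  have \<sigma>: "bij \<sigma>" "\<And>x y. \<sigma> (x + y) = \<sigma> x + \<sigma> y" "\<And>x y. \<sigma> (x * y) = \<sigma> x * \<sigma> y"
    "\<And>c. \<sigma> (to_ac c) = to_ac c"
    using assms unfolding galois_group_def by auto
  have eqI: "inv_into UNIV \<sigma> y = x" if "\<sigma> x = y" for x y
    using that \<sigma>(1) by (metis bij_is_inj inv_f_f)
  have "\<sigma> (inv_into UNIV \<sigma> y) = y" for y using \<sigma>(1) by (simp add: bij_is_surj surj_f_inv_f)
  then show ?thesis
    unfolding galois_group_def using \<sigma> by (auto intro!: eqI bij_imp_bij_inv)
qed

lemma inv_inv_galois: "\<sigma> \<in> galois_group \<Longrightarrow> inv_into UNIV (inv_into UNIV \<sigma>) = \<sigma>"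
  unfolding galois_group_def by (auto intro: inv_inv_eq)

lemma ff_map_morphism:
  assumes "\<sigma> \<in> galois_group"
  shows "fract_morphism (\<lambda>p. Fract (map_poly \<sigma> p) 1)" "ring_morphism (map_ratfun \<sigma>)"
    "map_ratfun \<sigma> r = 0 \<longleftrightarrow> r = 0"
    "q \<noteq> 0 \<Longrightarrow> map_ratfun \<sigma> (Fract p q) = Fract (map_poly \<sigma> p) (map_poly \<sigma> q)"
proof -
  show m: "fract_morphism (\<lambda>p. Fract (map_poly \<sigma> p) 1)"
    using galois_group_morphism[OF assms] by (intro fract_morphism_map_poly) auto
  then interpret m: fract_morphism "\<lambda>p. Fract (map_poly \<sigma> p) 1" .
  show "ring_morphism (map_ratfun \<sigma>)"
    unfolding map_ratfun_eq_fract_lift by (rule m.lift.ring_morphism_axioms)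
  show "map_ratfun \<sigma> r = 0 \<longleftrightarrow> r = 0"
    unfolding map_ratfun_eq_fract_lift by (rule m.fract_lift_eq_0_iff)
  show "q \<noteq> 0 \<Longrightarrow> map_ratfun \<sigma> (Fract p q) = Fract (map_poly \<sigma> p) (map_poly \<sigma> q)"
    unfolding map_ratfun_eq_fract_lift by (simp add: m.fract_lift_Fract)
qed

lemma ff_map_inv:
  assumes "\<sigma> \<in> galois_group"
  shows "ff_map \<sigma> (ff_map (inv_into UNIV \<sigma>) h) = h"
proof -
  have \<sigma>: "bij \<sigma>" using assms by (simp add: galois_group_def)
  note inv = galois_group_inv[OF assms]
  have comp: "\<sigma> \<circ> inv_into UNIV \<sigma> = (\<lambda>x. x)"
    using \<sigma> by (auto simp: bij_is_surj surj_f_inv_f)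
  have poly: "map_poly \<sigma> (map_poly (inv_into UNIV \<sigma>) p) = p" for p
    using galois_group_morphism(2)[OF assms, of 0] galois_group_morphism(2)[OF inv, of 0]
    by (subst map_poly_map_poly) (simp_all add: comp)
  have "map_ratfun \<sigma> (map_ratfun (inv_into UNIV \<sigma>) r) = r" for r
  proof (cases r)
    case (Fract p q)
    have "map_poly (inv_into UNIV \<sigma>) q \<noteq> 0"
      using Fract(2) galois_group_morphism(2)[OF inv] by (simp add: map_poly_eq_0_iff)
    then show ?thesis
      using Fract by (simp add: ff_map_morphism(4)[OF assms] ff_map_morphism(4)[OF inv] poly)
  qed
  then show ?thesis by (simp add: ff_map_def)
qed

section \<open>Degrees of divisors and the permutation action on them\<close>

definition frag_degree :: "('b \<Rightarrow>\<^sub>0 int) \<Rightarrow> int" where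
  "frag_degree d = (\<Sum>v\<in>Poly_Mapping.keys d. Poly_Mapping.lookup d v)"

lemma frag_degree_superset:
  assumes "finite S" "Poly_Mapping.keys d \<subseteq> S"
  shows "frag_degree d = (\<Sum>v\<in>S. Poly_Mapping.lookup d v)"
  unfolding frag_degree_def
  by (rule sum.mono_neutral_left) (use assms in \<open>auto simp: in_keys_iff\<close>)

lemma frag_degree_diff: "frag_degree (a - b) = frag_degree a - frag_degree b"
proof -
  let ?S = "Poly_Mapping.keys a \<union> Poly_Mapping.keys b"
  have "frag_degree (a - b) = (\<Sum>v\<in>?S. Poly_Mapping.lookup (a - b) v)"
    using keys_diff[of a b] by (intro frag_degree_superset) auto
  also have "\<dots> = frag_degree a - frag_degree b"
    by (simp add: frag_degree_superset[of ?S] lookup_minus sum_subtractf)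
  finally show ?thesis .
qed

lemma frag_degree_0 [simp]: "frag_degree 0 = 0"
  by (simp add: frag_degree_def)

lemma frag_degree_minus: "frag_degree (- a) = - frag_degree a"
  using frag_degree_diff[of 0 a] by simp

lemma frag_degree_add: "frag_degree (a + b) = frag_degree a + frag_degree b"
  using frag_degree_diff[of a "- b"] frag_degree_minus[of b] by simp

lemma frag_degree_of [simp]: "frag_degree (frag_of a) = 1"
  by (simp add: frag_degree_def)

lemma frag_degree_extend: "frag_degree (frag_extend (\<lambda>v. frag_of (f v)) d) = frag_degree d"
  using subset_UNIV
  by (induction d rule: frag_induction)
    (simp_all add: frag_extend_diff frag_degree_diff)

lemma lookup_frag_extend_bij:
  assumes "\<And>v. f' (f v) = v" "\<And>v. f (f' v) = v"
  shows "Poly_Mapping.lookup (frag_extend (\<lambda>v. frag_of (f v)) d) w = Poly_Mapping.lookup d (f' w)"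
  using subset_UNIV
proof (induction d rule: frag_induction)
  case (one x)
  then show ?case using assms by auto
qed (simp_all add: frag_extend_diff lookup_minus)

lemma galois_place_inv:
  assumes "\<sigma> \<in> galois_group"
  shows "galois_place \<sigma> (galois_place (inv_into UNIV \<sigma>) v) = v"
    "galois_place (inv_into UNIV \<sigma>) (galois_place \<sigma> v) = v"
  using ff_map_inv[OF assms] ff_map_inv[OF galois_group_inv[OF assms]] assms
  by (simp_all add: fun_eq_iff galois_place_eq inv_inv_galois)

lemma galois_divisor_inv:
  assumes "\<sigma> \<in> galois_group"
  shows "galois_divisor \<sigma> (galois_divisor (inv_into UNIV \<sigma>) d) = d"
  by (rule poly_mapping_eqI)
    (simp add: galois_divisor_def galois_place_inv[OF assms]
      lookup_frag_extend_bij[of "galois_place (inv_into UNIV \<sigma>)" "galois_place \<sigma>"]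
      lookup_frag_extend_bij[of "galois_place \<sigma>" "galois_place (inv_into UNIV \<sigma>)"])

section \<open>Galois action on local expansions and on places\<close>

lemma fls_map_subst:
  assumes "ring_morphism \<sigma>" "\<And>x. \<sigma> x = 0 \<longleftrightarrow> x = 0" "fls_map \<sigma> T = T"
  shows "fls_map \<sigma> (subst_fls T p) = subst_fls T (map_poly \<sigma> p)"
proof -
  interpret ring_morphism \<sigma> by fact
  interpret F: ring_morphism "fls_map \<sigma>" by (rule ring_morphism_fls_map[OF assms(1,2)])
  have const: "fls_map \<sigma> (fls_const a) = fls_const (\<sigma> a)" for a
    by (intro fls_eqI) (simp add: fls_nth_map hom_zero)
  show ?thesis
    by (induction p) (simp_all add: subst_fls_pCons map_poly_pCons hom_zero F.hom_simps const assms(3))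
qed

context rational_point
begin

abbreviation "Pl \<equiv> places (to_ac A) (map_poly to_ac g)"

lemma map_poly_galois_G: "\<sigma> \<in> galois_group \<Longrightarrow> map_poly \<sigma> G = G"
  unfolding G_eq using galois_group_morphism[of \<sigma>]
  by (subst map_poly_map_poly) (auto simp: comp_def)

context
  fixes \<sigma> :: "'k alg_closure \<Rightarrow> 'k alg_closure"
  assumes \<sigma>: "\<sigma> \<in> galois_group"
begin

interpretation r: ring_morphism "map_ratfun \<sigma>" by (rule ff_map_morphism(2)[OF \<sigma>])

lemma ff_map_mult:
  "ff_map \<sigma> (ff_mult (to_ac A) (map_poly to_ac g) h k)
    = ff_mult (to_ac A) (map_poly to_ac g) (ff_map \<sigma> h) (ff_map \<sigma> k)"
proof -
  have "map_ratfun \<sigma> (Fract G 1) = Fract G 1"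
    using galois_group_morphism[OF \<sigma>] map_poly_galois_G[OF \<sigma>] ff_map_morphism(4)[OF \<sigma>, of 1 G]
    by (simp add: ring_morphism.hom_one)
  then show ?thesis by (simp add: ff_mult_eq Fract_G ff_map_def r.hom_simps)
qed

lemma ff_map_add: "ff_map \<sigma> (h + k) = ff_map \<sigma> h + ff_map \<sigma> k"
  by (simp add: ff_map_def r.hom_simps)

lemma ff_map_eq_0_iff: "ff_map \<sigma> h = 0 \<longleftrightarrow> h = 0"
  by (simp add: ff_map_def zero_prod_def ff_map_morphism(3)[OF \<sigma>] prod_eq_iff)

lemma ff_map_const: "ff_map \<sigma> (Fract [:c:] 1, 0) = (Fract [:\<sigma> c:] 1, 0)"
  using galois_group_morphism[OF \<sigma>] ff_map_morphism(4)[OF \<sigma>, of 1 "[:c:]"]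
  by (simp add: ff_map_def r.hom_zero map_poly_pCons ring_morphism.hom_one)

lemma ff_series_map:
  assumes "fls_map \<sigma> Z = Z" "fls_map \<sigma> T = T"
  shows "ff_series T Z (ff_map \<sigma> h) = fls_map \<sigma> (ff_series T Z h)"
proof -
  note m = galois_group_morphism[OF \<sigma>]
  interpret F: ring_morphism "fls_map \<sigma>" by (rule ring_morphism_fls_map[OF m(1,2)])
  have "fls_lift T (map_ratfun \<sigma> r) = fls_map \<sigma> (fls_lift T r)" for r
  proof (cases r)
    case (Fract p q)
    have nz: "subst_fls T q \<noteq> 0" "map_poly \<sigma> q \<noteq> 0"
      using Fract(2) m(2) by (simp_all add: P.subst.hom_nonzero map_poly_eq_0_iff)
    have "fls_map \<sigma> (fls_lift T r) * fls_map \<sigma> (subst_fls T q) = fls_map \<sigma> (subst_fls T p)"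
      using Fract nz by (simp add: P.subst.fract_lift_Fract flip: F.hom_mult)
    then have "fls_map \<sigma> (fls_lift T r) * subst_fls T (map_poly \<sigma> q) = subst_fls T (map_poly \<sigma> p)"
      using fls_map_subst[OF m(1,2) assms(2)] by simp
    then show ?thesis
      using Fract nz P.subst.hom_nonzero[OF nz(2)]
      by (simp add: ff_map_morphism(4)[OF \<sigma>] P.subst.fract_lift_Fract nonzero_divide_eq_eq)
  qed
  then show ?thesis by (simp add: ff_series_def ff_map_def F.hom_simps assms(1))
qed

lemma fls_map_T: "fls_map \<sigma> T = T"
  using galois_group_morphism(3)[OF \<sigma>, of 0] galois_group_morphism(3)[OF \<sigma>, of 1]
    galois_group_morphism(3)[OF \<sigma>, of x0]
  by (intro fls_eqI) (simp add: fls_nth_map T_def)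

text \<open>The conjugate series is again a square root of \<open>G(T)\<close>, hence
  \<open>Y\<close> or \<open>- Y\<close>; its constant term \<open>y0\<close> is fixed, which
  excludes the minus sign.\<close>

lemma fls_map_Y: "fls_map \<sigma> Y = Y"
proof -
  note m = galois_group_morphism[OF \<sigma>]
  interpret F: ring_morphism "fls_map \<sigma>" by (rule ring_morphism_fls_map[OF m(1,2)])
  have "fls_map \<sigma> Y ^ 2 = fls_map \<sigma> (subst_fls T G)"
    by (simp add: F.hom_power flip: P.Y_square)
  also have "\<dots> = Y ^ 2"
    by (simp add: fls_map_subst[OF m(1,2) fls_map_T] map_poly_galois_G[OF \<sigma>] P.Y_square)
  finally have "fls_map \<sigma> Y = Y \<or> fls_map \<sigma> Y = - Y" by (simp add: power2_eq_iff)
  moreover have "fls_map \<sigma> Y $$ 0 = to_ac y0"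
    using m(2)[of 0] m(3)[of y0] by (simp add: fls_nth_map Y_nth_0)
  moreover have "(- Y) $$ 0 \<noteq> to_ac y0"
  proof
    assume "(- Y) $$ 0 = to_ac y0"
    then have "to_ac (2 * y0) = 0" by (simp add: Y_nth_0)
    then show False using y0_nonzero to_ac_eq_0_iff[of "2 * y0"] by simp
  qed
  ultimately show ?thesis by auto
qed

lemma series_place_ff_map:
  "series_place T Y (ff_map \<sigma> h) = series_place T Y h"
  "series_place T (- Y) (ff_map \<sigma> h) = series_place T (- Y) h"
proof -
  note m = galois_group_morphism[OF \<sigma>]
  interpret F: ring_morphism "fls_map \<sigma>" by (rule ring_morphism_fls_map[OF m(1,2)])
  have "fls_map \<sigma> (- Y) = - Y" by (simp add: F.hom_uminus fls_map_Y)
  then show "series_place T Y (ff_map \<sigma> h) = series_place T Y h"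
    "series_place T (- Y) (ff_map \<sigma> h) = series_place T (- Y) h"
    using ff_series_map[OF fls_map_Y fls_map_T]
      ff_series_map[OF _ fls_map_T] m(2)
    by (simp_all add: series_place_def fls_subdegree_map)
qed

end

lemma galois_place_P:
  assumes "\<sigma> \<in> galois_group"
  shows "galois_place \<sigma> (series_place T Y) = series_place T Y"
    "galois_place \<sigma> (series_place T (- Y)) = series_place T (- Y)"
  using series_place_ff_map[OF galois_group_inv[OF assms]]
  by (simp_all add: fun_eq_iff galois_place_eq)

text \<open>The valuation axioms are transported along the automorphism of the function field;
  surjectivity uses the inverse automorphism.\<close>

lemma galois_place_in_places:
  assumes \<sigma>: "\<sigma> \<in> galois_group" and v: "v \<in> Pl"
  shows "galois_place \<sigma> v \<in> Pl"
proof -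
  define \<tau> where "\<tau> = inv_into UNIV \<sigma>"
  have \<tau>: "\<tau> \<in> galois_group" unfolding \<tau>_def by (rule galois_group_inv[OF \<sigma>])
  have eq: "galois_place \<sigma> v h = v (ff_map \<tau> h)" for h by (simp add: galois_place_eq \<tau>_def)
  have v0: "v 0 = 0" and surj: "v ` (- {0}) = UNIV"
    and add: "\<And>h k. h \<noteq> 0 \<Longrightarrow> k \<noteq> 0 \<Longrightarrow> h + k \<noteq> 0 \<Longrightarrow> min (v h) (v k) \<le> v (h + k)"
    and const: "\<And>c. c \<noteq> 0 \<Longrightarrow> v (Fract [:c:] 1, 0) = 0"
    using v unfolding places_def by blast+
  show ?thesis
    unfolding places_def mem_Collect_eq
  proof (intro conjI allI impI)
    show "galois_place \<sigma> v 0 = 0" using ff_map_eq_0_iff[OF \<tau>, of 0] v0 by (simp add: eq)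
    show "galois_place \<sigma> v ` (- {0}) = UNIV"
    proof -
      have "n \<in> galois_place \<sigma> v ` (- {0})" for n
      proof -
        have "n \<in> v ` (- {0})" by (simp add: surj)
        then obtain h where h: "h \<noteq> 0" "v h = n" by auto
        have "galois_place \<sigma> v (ff_map \<sigma> h) = n"
          using ff_map_inv[OF \<tau>, of h] h(2) inv_inv_galois[OF \<sigma>] unfolding eq by (simp add: \<tau>_def)
        then show ?thesis using h(1) ff_map_eq_0_iff[OF \<sigma>, of h] by (auto intro: rev_image_eqI)
      qed
      then show ?thesis by auto
    qed
    show "galois_place \<sigma> v (ff_mult (to_ac A) (map_poly to_ac g) h k)
        = galois_place \<sigma> v h + galois_place \<sigma> v k" if "h \<noteq> 0" "k \<noteq> 0" for h k
      unfolding eq ff_map_mult[OF \<tau>]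
      by (rule places_mult[OF v]) (use that ff_map_eq_0_iff[OF \<tau>] in auto)
    show "min (galois_place \<sigma> v h) (galois_place \<sigma> v k) \<le> galois_place \<sigma> v (h + k)"
      if "h \<noteq> 0" "k \<noteq> 0" "h + k \<noteq> 0" for h k
    proof -
      have "ff_map \<tau> h + ff_map \<tau> k \<noteq> 0"
        using ff_map_eq_0_iff[OF \<tau>, of "h + k"] that(3) ff_map_add[OF \<tau>] by simp
      then show ?thesis
        unfolding eq ff_map_add[OF \<tau>]
        by (intro add) (use that ff_map_eq_0_iff[OF \<tau>] in auto)
    qed
    show "galois_place \<sigma> v (Fract [:c:] 1, 0) = 0" if "c \<noteq> 0" for c
      unfolding eq ff_map_const[OF \<tau>]
      by (rule const) (use that galois_group_morphism(2)[OF \<tau>] in auto)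
  qed
qed

end

subsection \<open>The class of the point in the Jacobian\<close>

context rational_point
begin

abbreviation "D0 \<equiv> div0_group (to_ac A) (map_poly to_ac g)"
abbreviation "Pr \<equiv> principal_divisors (to_ac A) (map_poly to_ac g)"
abbreviation "Pic \<equiv> Pic0 (to_ac A) (map_poly to_ac g)"
abbreviation "Jac \<equiv> jacobian_points A g"

lemma carrier_D0: "d \<in> carrier D0 \<longleftrightarrow> Poly_Mapping.keys d \<subseteq> Pl \<and> frag_degree d = 0"
  by (simp add: div0_group_def frag_degree_def)

lemma mult_D0 [simp]: "x \<otimes>\<^bsub>D0\<^esub> y = x + y"
  by (simp add: div0_group_def)

lemma one_D0 [simp]: "\<one>\<^bsub>D0\<^esub> = 0"
  by (simp add: div0_group_def)

sublocale D0: comm_group D0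
proof (rule comm_groupI)
  fix x y assume "x \<in> carrier D0" "y \<in> carrier D0"
  then show "x \<otimes>\<^bsub>D0\<^esub> y \<in> carrier D0"
    using keys_add[of x y] by (auto simp: carrier_D0 frag_degree_add)
next
  fix x assume "x \<in> carrier D0"
  then show "\<exists>y\<in>carrier D0. y \<otimes>\<^bsub>D0\<^esub> x = \<one>\<^bsub>D0\<^esub>"
    by (intro bexI[of _ "- x"]) (auto simp: carrier_D0 frag_degree_minus)
qed (auto simp: carrier_D0 algebra_simps)

lemma inv_D0: "x \<in> carrier D0 \<Longrightarrow> inv\<^bsub>D0\<^esub> x = - x"
  by (rule D0.inv_equality) (auto simp: carrier_D0 frag_degree_minus)

lemma Pr_iff: "d \<in> Pr \<longleftrightarrow> d \<in> carrier D0 \<and> (\<exists>h. h \<noteq> 0 \<and> (\<forall>v\<in>Pl. Poly_Mapping.lookup d v = v h))"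
  by (simp add: principal_divisors_def)

lemma Pr_subgroup: "subgroup Pr D0"
proof (rule D0.subgroupI)
  show "Pr \<subseteq> carrier D0" by (auto simp: Pr_iff)
  have "(1, 0) \<noteq> (0 :: 'k alg_closure ff_elem)" by (simp add: zero_prod_def)
  moreover have "0 \<in> carrier D0" using D0.one_closed by simp
  moreover have "\<forall>v\<in>Pl. Poly_Mapping.lookup 0 v = v (1, 0)" using places_one by (metis lookup_zero)
  ultimately have "0 \<in> Pr" unfolding Pr_iff by blast
  then show "Pr \<noteq> {}" by auto
next
  fix a assume a: "a \<in> Pr"
  then obtain h where h: "h \<noteq> 0" "\<And>v. v \<in> Pl \<Longrightarrow> Poly_Mapping.lookup a v = v h"
    by (auto simp: Pr_iff)
  obtain k where k: "k \<noteq> 0" "ff_mult (to_ac A) (map_poly to_ac g) h k = (1, 0)"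
    using ff_mult_inverse_exists[OF h(1)] by blast
  have a': "a \<in> carrier D0" using a by (simp add: Pr_iff)
  then have "- a \<in> carrier D0" using D0.inv_closed[OF a'] by (simp add: inv_D0)
  moreover have "\<forall>v\<in>Pl. Poly_Mapping.lookup (- a) v = v k"
    using place_inverse[OF _ h(1) k] h(2) by simp
  ultimately have "- a \<in> Pr" using k(1) unfolding Pr_iff by blast
  then show "inv\<^bsub>D0\<^esub> a \<in> Pr" using a' by (simp add: inv_D0)
next
  fix a b assume ab: "a \<in> Pr" "b \<in> Pr"
  then obtain h k where h: "h \<noteq> 0" "\<And>v. v \<in> Pl \<Longrightarrow> Poly_Mapping.lookup a v = v h"
    and k: "k \<noteq> 0" "\<And>v. v \<in> Pl \<Longrightarrow> Poly_Mapping.lookup b v = v k"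
    by (auto simp: Pr_iff)
  have "a + b \<in> carrier D0"
    using ab D0.m_closed[of a b] by (simp add: Pr_iff)
  moreover have "\<forall>v\<in>Pl. Poly_Mapping.lookup (a + b) v = v (ff_mult (to_ac A) (map_poly to_ac g) h k)"
    using places_mult[OF _ h(1) k(1)] h(2) k(2) by (simp add: lookup_add)
  ultimately have "a + b \<in> Pr" using ff_mult_nonzero[OF h(1) k(1)] unfolding Pr_iff by blast
  then show "a \<otimes>\<^bsub>D0\<^esub> b \<in> Pr" by simp
qed

sublocale Pr: normal Pr D0
  using D0.normal_iff_subgroup Pr_subgroup by blast

sublocale Pic: comm_group Pic
  unfolding Pic0_def by (rule D0.abelian_FactGroup[OF Pr_subgroup])

lemma Pic_simps: "carrier Pic = rcosets\<^bsub>D0\<^esub> Pr" "\<one>\<^bsub>Pic\<^esub> = Pr" "c \<otimes>\<^bsub>Pic\<^esub> c' = c <#>\<^bsub>D0\<^esub> c'"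
  by (simp_all add: Pic0_def FactGroup_def)

lemma inv_Pic:
  assumes "c \<in> carrier Pic"
  shows "inv\<^bsub>Pic\<^esub> c = uminus ` c"
proof -
  have "c \<subseteq> carrier D0"
    using assms Pr.subset D0.r_coset_subset_G unfolding Pic_simps RCOSETS_def by blast
  moreover have "inv\<^bsub>Pic\<^esub> c = set_inv\<^bsub>D0\<^esub> c"
    using Pr.inv_FactGroup assms unfolding Pic0_def by blast
  ultimately show ?thesis
    unfolding SET_INV_def by (auto simp: inv_D0 subset_iff)
qed

lemma galois_divisor_minus: "galois_divisor \<sigma> (- x) = - galois_divisor \<sigma> x"
  by (simp add: galois_divisor_def frag_extend_minus)

lemma galois_divisor_add: "galois_divisor \<sigma> (x + y) = galois_divisor \<sigma> x + galois_divisor \<sigma> y"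
  by (simp add: galois_divisor_def frag_extend_add)

lemma galois_divisor_D0:
  assumes \<sigma>: "\<sigma> \<in> galois_group" and "d \<in> carrier D0"
  shows "galois_divisor \<sigma> d \<in> carrier D0"
proof -
  have "Poly_Mapping.keys (galois_divisor \<sigma> d) \<subseteq> galois_place \<sigma> ` Poly_Mapping.keys d"
    using keys_frag_extend[of "\<lambda>v. frag_of (galois_place \<sigma> v)" d] by (auto simp: galois_divisor_def)
  then show ?thesis
    using assms(2) galois_place_in_places[OF \<sigma>]
    by (auto simp: carrier_D0 galois_divisor_def frag_degree_extend)
qed

text \<open>If \<open>d\<close> is the divisor of \<open>h\<close>, then its conjugate is the
  divisor of \<open>ff_map \<sigma> h\<close>.\<close>

lemma galois_divisor_Pr_subset:
  assumes \<sigma>: "\<sigma> \<in> galois_group"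
  shows "galois_divisor \<sigma> ` Pr \<subseteq> Pr"
proof (intro image_subsetI)
  fix d assume d: "d \<in> Pr"
  then obtain h where h: "h \<noteq> 0" "\<And>v. v \<in> Pl \<Longrightarrow> Poly_Mapping.lookup d v = v h"
    by (auto simp: Pr_iff)
  have "Poly_Mapping.lookup (galois_divisor \<sigma> d) w = w (ff_map \<sigma> h)" if "w \<in> Pl" for w
  proof -
    have "Poly_Mapping.lookup (galois_divisor \<sigma> d) w
        = Poly_Mapping.lookup d (galois_place (inv_into UNIV \<sigma>) w)"
      unfolding galois_divisor_def
      by (rule lookup_frag_extend_bij) (simp_all add: galois_place_inv[OF \<sigma>])
    also have "\<dots> = galois_place (inv_into UNIV \<sigma>) w h"
      by (intro h(2) galois_place_in_places galois_group_inv \<sigma> that)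
    finally show ?thesis by (simp add: galois_place_eq inv_inv_galois[OF \<sigma>])
  qed
  moreover have "galois_divisor \<sigma> d \<in> carrier D0"
    using d galois_divisor_D0[OF \<sigma>] by (simp add: Pr_iff)
  ultimately show "galois_divisor \<sigma> d \<in> Pr"
    using ff_map_eq_0_iff[OF \<sigma>, of h] h(1) unfolding Pr_iff by blast
qed

lemma galois_divisor_Pr:
  assumes \<sigma>: "\<sigma> \<in> galois_group"
  shows "galois_divisor \<sigma> ` Pr = Pr"
proof
  show "Pr \<subseteq> galois_divisor \<sigma> ` Pr"
  proof
    fix d assume "d \<in> Pr"
    then have "galois_divisor (inv_into UNIV \<sigma>) d \<in> Pr"
      using galois_divisor_Pr_subset[OF galois_group_inv[OF \<sigma>]] by blast
    then show "d \<in> galois_divisor \<sigma> ` Pr"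
      using galois_divisor_inv[OF \<sigma>, of d] by (metis imageI)
  qed
qed (rule galois_divisor_Pr_subset[OF \<sigma>])

lemma carrier_Jac: "c \<in> carrier Jac \<longleftrightarrow>
    c \<in> carrier Pic \<and> (\<forall>\<sigma>\<in>galois_group. galois_divisor \<sigma> ` c = c)"
  by (simp add: jacobian_points_def)

lemma Jac_simps: "c \<otimes>\<^bsub>Jac\<^esub> c' = c \<otimes>\<^bsub>Pic\<^esub> c'" "\<one>\<^bsub>Jac\<^esub> = \<one>\<^bsub>Pic\<^esub>"
  by (simp_all add: jacobian_points_def)

text \<open>The Galois action on divisors is additive and stabilises the principal divisors, so
  invariant classes are closed under the group operations.\<close>

sublocale Jac: comm_group Jac
proof (rule comm_groupI)
  fix c c' assume "c \<in> carrier Jac" "c' \<in> carrier Jac"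
  moreover have "galois_divisor \<sigma> ` (c <#>\<^bsub>D0\<^esub> c') = galois_divisor \<sigma> ` c <#>\<^bsub>D0\<^esub> galois_divisor \<sigma> ` c'" for \<sigma>
    by (simp add: set_mult_def image_UN galois_divisor_add)
  ultimately show "c \<otimes>\<^bsub>Jac\<^esub> c' \<in> carrier Jac"
    using Pic.m_closed[of c c'] by (simp add: carrier_Jac Jac_simps) (simp add: Pic_simps)
next
  show "\<one>\<^bsub>Jac\<^esub> \<in> carrier Jac"
    using Pic.one_closed galois_divisor_Pr by (auto simp: carrier_Jac Jac_simps Pic_simps(2))
next
  fix c assume c: "c \<in> carrier Jac"
  have "galois_divisor \<sigma> ` uminus ` c = uminus ` galois_divisor \<sigma> ` c" for \<sigma>
    by (simp add: image_image galois_divisor_minus)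
  then have "inv\<^bsub>Pic\<^esub> c \<in> carrier Jac"
    using c Pic.inv_closed[of c] by (auto simp: carrier_Jac inv_Pic)
  moreover have "inv\<^bsub>Pic\<^esub> c \<otimes>\<^bsub>Jac\<^esub> c = \<one>\<^bsub>Jac\<^esub>"
    using c Pic.l_inv[of c] by (simp add: carrier_Jac Jac_simps)
  ultimately show "\<exists>c'\<in>carrier Jac. c' \<otimes>\<^bsub>Jac\<^esub> c = \<one>\<^bsub>Jac\<^esub>" by blast
next
  fix c c' c'' assume "c \<in> carrier Jac" "c' \<in> carrier Jac" "c'' \<in> carrier Jac"
  then show "c \<otimes>\<^bsub>Jac\<^esub> c' \<otimes>\<^bsub>Jac\<^esub> c'' = c \<otimes>\<^bsub>Jac\<^esub> (c' \<otimes>\<^bsub>Jac\<^esub> c'')"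
    unfolding carrier_Jac Jac_simps by (intro Pic.m_assoc) auto
next
  fix c c' assume "c \<in> carrier Jac" "c' \<in> carrier Jac"
  then show "c \<otimes>\<^bsub>Jac\<^esub> c' = c' \<otimes>\<^bsub>Jac\<^esub> c"
    unfolding carrier_Jac Jac_simps by (intro Pic.m_comm) auto
qed (simp add: carrier_Jac Jac_simps)

text \<open>The divisor \<open>P - P'\<close>, which has degree 0 without the help of a rational
  base point.\<close>

definition P_div :: "('k alg_closure ff_elem \<Rightarrow> int) \<Rightarrow>\<^sub>0 int" where
  "P_div = frag_of (series_place T Y) - frag_of (series_place T (- Y))"

definition P_class :: "(('k alg_closure ff_elem \<Rightarrow> int) \<Rightarrow>\<^sub>0 int) set" where
  "P_class = Pr #>\<^bsub>D0\<^esub> P_div"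

lemma P_div_D0: "P_div \<in> carrier D0"
  using places_P keys_diff[of "frag_of (series_place T Y)" "frag_of (series_place T (- Y))"]
  by (auto simp: carrier_D0 P_div_def frag_degree_diff)

lemma galois_divisor_P_div: "\<sigma> \<in> galois_group \<Longrightarrow> galois_divisor \<sigma> P_div = P_div"
  by (simp add: P_div_def galois_divisor_def frag_extend_diff galois_place_P)

text \<open>The representative \<open>P - P'\<close> is itself fixed by the Galois group, and the
  principal divisors are stable as a set.\<close>

lemma P_class_Jac: "P_class \<in> carrier Jac"
proof -
  have "galois_divisor \<sigma> ` P_class = P_class" if \<sigma>: "\<sigma> \<in> galois_group" for \<sigma>
  proof -
    have "P_class = (\<lambda>p. p + P_div) ` Pr" by (auto simp: P_class_def r_coset_def)
    then have "galois_divisor \<sigma> ` P_class = (\<lambda>p. p + P_div) ` galois_divisor \<sigma> ` Pr"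
      by (simp add: image_image galois_divisor_add galois_divisor_P_div[OF \<sigma>])
    then show ?thesis
      unfolding galois_divisor_Pr[OF \<sigma>] by (simp add: \<open>P_class = _\<close>)
  qed
  moreover have "P_class \<in> carrier Pic"
    unfolding Pic_simps P_class_def RCOSETS_def using P_div_D0 by blast
  ultimately show ?thesis by (simp add: carrier_Jac)
qed

lemma P_class_pow:
  "frag_cmul (int n) P_div \<in> carrier D0 \<and> P_class [^]\<^bsub>Jac\<^esub> n = Pr #>\<^bsub>D0\<^esub> frag_cmul (int n) P_div"
proof (induction n)
  case 0
  show ?case
    using D0.one_closed D0.coset_mult_one[OF Pr.subset] by (simp add: Jac_simps Pic_simps)
next
  case (Suc n)
  have eq: "frag_cmul (int (Suc n)) P_div = frag_cmul (int n) P_div \<otimes>\<^bsub>D0\<^esub> P_div"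
    by (simp add: frag_cmul_distrib add.commute)
  have "P_class [^]\<^bsub>Jac\<^esub> Suc n = (Pr #>\<^bsub>D0\<^esub> frag_cmul (int n) P_div) <#>\<^bsub>D0\<^esub> (Pr #>\<^bsub>D0\<^esub> P_div)"
    using Suc by (simp add: Jac_simps Pic_simps P_class_def)
  also have "\<dots> = Pr #>\<^bsub>D0\<^esub> frag_cmul (int (Suc n)) P_div"
    unfolding eq by (rule Pr.rcos_sum) (use Suc P_div_D0 in auto)
  finally show ?case unfolding eq using Suc P_div_D0 D0.m_closed by blast
qed

text \<open>If a positive multiple of the class of \<open>P - P'\<close> were trivial, the function
  realising it would lead to the Pell equation excluded by \<open>pell_equation_no_solution\<close>.
  So this class alone is an independent set.\<close>

lemma mordell_weil_rank_positive:
  fixes d :: "'k poly \<Rightarrow> 'k poly"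
  assumes d_add: "\<And>a b. d (a + b) = d a + d b"
    and d_mult: "\<And>a b. d (a * b) = d a * b + a * d b"
    and d_degree: "\<And>a. degree (d a) \<le> degree a"
    and d_H: "d H = [:2 * l:] * H"
    and d_lin: "poly (d [:-x0, 1:]) x0 \<noteq> 0"
  shows "mordell_weil_rank A g > 0"
proof -
  have torsion_free: "P_class [^]\<^bsub>Jac\<^esub> n \<noteq> \<one>\<^bsub>Jac\<^esub>" if "n > 0" for n :: nat
  proof
    assume "P_class [^]\<^bsub>Jac\<^esub> n = \<one>\<^bsub>Jac\<^esub>"
    then have "Pr #>\<^bsub>D0\<^esub> frag_cmul (int n) P_div = Pr"
      using P_class_pow[of n] by (simp add: Jac_simps Pic_simps)
    moreover have "frag_cmul (int n) P_div \<in> Pr #>\<^bsub>D0\<^esub> frag_cmul (int n) P_div"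
      using P_class_pow[of n] Pr_subgroup by (intro D0.rcos_self) auto
    ultimately have "frag_cmul (int n) P_div \<in> Pr" by simp
    then obtain h where h: "h \<noteq> 0"
      "\<And>v. v \<in> Pl \<Longrightarrow> Poly_Mapping.lookup (frag_cmul (int n) P_div) v = v h"
      by (auto simp: Pr_iff)
    have lookup: "Poly_Mapping.lookup (frag_cmul (int n) P_div) v
        = (if v = series_place T Y then int n else if v = series_place T (- Y) then - int n else 0)" for v
      using places_P_distinct by (simp add: P_div_def lookup_minus)
    have v: "series_place T Y h = int n" "series_place T (- Y) h = - int n"
      using h(2)[OF places_P(1)] h(2)[OF places_P(2)] places_P_distinct unfolding lookup by auto
    have others: "v h = 0" if "v \<in> Pl" "v \<noteq> series_place T Y" "v \<noteq> series_place T (- Y)" for v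
      using h(2)[OF that(1)] that(2,3) unfolding lookup by simp
    obtain p q c where pq: "q \<noteq> 0" "degree p \<le> n" "2 * degree q + degree H \<le> 2 * n" "c \<noteq> 0"
      "p ^ 2 - q ^ 2 * H = [:c:] * [:-x0, 1:] ^ (2 * n)"
      by (rule conjugate_divisor_imp_pell[OF \<open>n > 0\<close> h(1) v]) (use others in blast)+
    have "poly H x0 \<noteq> 0" "degree H \<ge> 3"
      using poly_H y0_nonzero degree_g A_nonzero by (simp_all add: H_def)
    then show False
      using pell_equation_no_solution[OF d_add d_mult d_degree d_H d_lin _ _ pq(1,4,2,3,5)] by blast
  qed
  have "int_independent Jac {P_class}"
    unfolding int_independent_def
  proof (intro conjI allI impI)
    fix k :: "_ \<Rightarrow> int"
    assume *: "(\<Otimes>\<^bsub>Jac\<^esub>s\<in>{P_class}. s [^]\<^bsub>Jac\<^esub> k s) = \<one>\<^bsub>Jac\<^esub>"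
    have "P_class [^]\<^bsub>Jac\<^esub> k P_class = \<one>\<^bsub>Jac\<^esub>"
      using * P_class_Jac by simp
    \<comment> \<open>Taking the inverse if necessary replaces the integer exponent by its absolute
      value, to which the statement on natural exponents applies.\<close>
    then have "P_class [^]\<^bsub>Jac\<^esub> (- k P_class) = \<one>\<^bsub>Jac\<^esub>"
      unfolding Jac.int_pow_neg[OF P_class_Jac] by (simp only: Jac.inv_one)
    with \<open>P_class [^]\<^bsub>Jac\<^esub> k P_class = \<one>\<^bsub>Jac\<^esub>\<close>
    have "P_class [^]\<^bsub>Jac\<^esub> \<bar>k P_class\<bar> = \<one>\<^bsub>Jac\<^esub>" by (metis abs_if)
    then have "P_class [^]\<^bsub>Jac\<^esub> int (nat \<bar>k P_class\<bar>) = \<one>\<^bsub>Jac\<^esub>" by simp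
    then have "P_class [^]\<^bsub>Jac\<^esub> nat \<bar>k P_class\<bar> = \<one>\<^bsub>Jac\<^esub>"
      unfolding int_pow_int .
    then have "nat \<bar>k P_class\<bar> = 0" using torsion_free by blast
    then show "\<forall>s\<in>{P_class}. k s = 0" by simp
  qed (use P_class_Jac in auto)
  then have "enat (card {P_class}) \<le> abelian_rank Jac"
    unfolding abelian_rank_def by (intro SUP_upper) simp
  then have "1 \<le> abelian_rank Jac" by (simp add: one_enat_def)
  then show ?thesis unfolding mordell_weil_rank_def by (metis ile0_eq not_gr_zero one_neq_zero)
qed

end

subsection \<open>Simultaneous twists\<close>

text \<open>Evaluating a Bezout identity at a multiple root shows that \<open>f\<close> and
  \<open>pderiv f\<close> have a non-constant greatest common divisor over the rationals. A prime
  factor of it cannot divide its own derivative, for degree reasons, so its square divides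
  \<open>f\<close>.\<close>

lemma squarefree_imp_simple_roots:
  fixes f :: "rat poly" and h :: "rat \<Rightarrow> 'a::field"
  assumes "squarefree f" "ring_morphism h" "poly (map_poly h f) x = 0"
  shows "poly (pderiv (map_poly h f)) x \<noteq> 0"
proof
  interpret ring_morphism h by fact
  interpret m: ring_morphism "map_poly h" by (rule ring_morphism_map_poly)
  assume der: "poly (pderiv (map_poly h f)) x = 0"
  have "f \<noteq> 0" using assms(1) by auto
  define k where "k = gcd f (pderiv f)"
  have "k \<noteq> 0" using \<open>f \<noteq> 0\<close> by (simp add: k_def)
  obtain u w where uw: "u * f + w * pderiv f = k"
    unfolding k_def using bezout_coefficients_fst_snd by blast
  have "poly (map_poly h k) x = 0"
    using assms(3) der by (simp add: uw[symmetric] m.hom_simps pderiv_hom)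
  moreover have "poly (map_poly h k) x \<noteq> 0" if unit: "is_unit k"
  proof -
    obtain c where c: "k = [:c:]" "c \<noteq> 0"
      using unit \<open>k \<noteq> 0\<close> by (metis degree_eq_zeroE is_unit_iff_degree pCons_0_0)
    have "h c * h (inverse c) = 1" using c(2) by (simp add: hom_one flip: hom_mult)
    then show ?thesis using c(1) by (auto simp: map_poly_pCons hom_zero)
  qed
  ultimately obtain \<pi> where \<pi>: "\<pi> dvd k" "prime \<pi>"
    using prime_divisor_exists[OF \<open>k \<noteq> 0\<close>] by blast
  then have dvd: "\<pi> dvd f" "\<pi> dvd pderiv f" by (auto simp: k_def)
  have prime: "prime_elem \<pi>" and nz: "\<pi> \<noteq> 0" using \<pi>(2) by auto
  obtain t where t: "f = \<pi> * t" using dvd(1) by (elim dvdE)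
  have "\<pi> dvd pderiv \<pi> * t"
    using dvd(2) unfolding t pderiv_mult by (simp add: dvd_add_right_iff mult.commute)
  moreover have "degree \<pi> > 0"
    using prime nz by (metis gr0I is_unit_iff_degree prime_elem_not_unit)
  then have "pderiv \<pi> \<noteq> 0" "degree (pderiv \<pi>) < degree \<pi>"
    by (auto simp: pderiv_eq_0_iff degree_pderiv)
  then have "\<not> \<pi> dvd pderiv \<pi>" by (meson dvd_imp_degree_le leD)
  ultimately have "\<pi> dvd t" using prime by (simp add: prime_elem_dvd_mult_iff)
  then have "\<pi> ^ 2 dvd f" unfolding t power2_eq_square by (intro mult_dvd_mono) auto
  then have "is_unit \<pi>" using assms(1) by (auto simp: squarefree_def)
  then show False using prime by (simp add: prime_elem_not_unit)
qed

section \<open>Derivations of the base field and ranks of the twists\<close>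

locale field_derivation =
  fixes \<delta> :: "'k::field_char_0 \<Rightarrow> 'k"
  assumes d_add: "\<delta> (a + b) = \<delta> a + \<delta> b"
    and d_mult: "\<delta> (a * b) = \<delta> a * b + a * \<delta> b"
begin

lemma d_zero [simp]: "\<delta> 0 = 0"
  using d_add[of 0 0] by (metis add_0 add_cancel_right_right)

lemma d_one [simp]: "\<delta> 1 = 0"
  using d_mult[of 1 1] by simp

lemma d_uminus: "\<delta> (- a) = - \<delta> a"
  using d_add[of a "- a"] by (simp add: eq_neg_iff_add_eq_0 add.commute)

lemma d_diff: "\<delta> (a - b) = \<delta> a - \<delta> b"
  using d_add[of a "- b"] by (simp add: d_uminus)

lemma d_of_nat [simp]: "\<delta> (of_nat n) = 0"
  by (induction n) (simp_all add: d_add)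

lemma d_numeral [simp]: "\<delta> (numeral n) = 0"
  using d_of_nat[of "numeral n"] by simp

lemma d_of_int [simp]: "\<delta> (of_int n) = 0"
  by (cases n) (simp_all add: d_uminus del: of_nat_Suc)

lemma d_of_rat [simp]: "\<delta> (of_rat r) = 0"
proof (cases r)
  case (Fract a b)
  then have "of_rat r * of_int b = (of_int a :: 'k)" by (simp add: of_rat_rat)
  then have "\<delta> (of_rat r) * of_int b = 0" using d_mult[of "of_rat r" "of_int b"] by simp
  then show ?thesis using Fract by simp
qed

lemma d_power2: "\<delta> (a ^ 2) = 2 * a * \<delta> a"
  by (simp add: power2_eq_square d_mult)

text \<open>The extension of \<open>\<delta>\<close> to polynomials that sends \<open>x\<close> to
  \<open>\<mu> * x\<close>. This form does not raise degrees, and \<open>\<mu>\<close> is free to be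
  adapted to the curve.\<close>

definition poly_d :: "'k \<Rightarrow> 'k poly \<Rightarrow> 'k poly" where
  "poly_d \<mu> p = map_poly \<delta> p + [:0, \<mu>:] * pderiv p"

lemma map_poly_d_add: "map_poly \<delta> (p + q) = map_poly \<delta> p + map_poly \<delta> q"
  by (intro poly_eqI) (simp add: coeff_map_poly d_add)

lemma map_poly_d_smult: "map_poly \<delta> (smult c p) = smult (\<delta> c) p + smult c (map_poly \<delta> p)"
  by (intro poly_eqI) (simp add: coeff_map_poly d_mult)

lemma map_poly_d_mult: "map_poly \<delta> (p * q) = map_poly \<delta> p * q + p * map_poly \<delta> q"
proof (induction p)
  case (pCons c p)
  have "map_poly \<delta> (pCons c p * q) = map_poly \<delta> (smult c q) + pCons 0 (map_poly \<delta> (p * q))"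
    by (simp add: map_poly_d_add map_poly_pCons)
  then show ?case
    unfolding pCons map_poly_d_smult by (simp add: map_poly_pCons algebra_simps)
qed simp

lemma poly_d_add: "poly_d \<mu> (p + q) = poly_d \<mu> p + poly_d \<mu> q"
  by (simp add: poly_d_def map_poly_d_add pderiv_add smult_add_right)

lemma poly_d_mult: "poly_d \<mu> (p * q) = poly_d \<mu> p * q + p * poly_d \<mu> q"
proof -
  have "M * (p * q' + q * p') = (M * p') * q + p * (M * q')" for M p' q' :: "'k poly"
    by (simp add: algebra_simps)
  then show ?thesis
    unfolding poly_d_def map_poly_d_mult pderiv_mult by (simp only: distrib_left distrib_right ac_simps)
qed

lemma degree_poly_d: "degree (poly_d \<mu> p) \<le> degree p"
  unfolding poly_d_def
proof (rule degree_add_le)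
  show "degree (map_poly \<delta> p) \<le> degree p"
    by (rule degree_le) (simp add: coeff_map_poly coeff_eq_0)
  show "degree ([:0, \<mu>:] * pderiv p) \<le> degree p"
  proof (cases "degree p = 0")
    case True
    then have "pderiv p = 0" by (simp add: pderiv_eq_0_iff)
    then show ?thesis by simp
  next
    case False
    have "degree ([:0, \<mu>:] * pderiv p) \<le> degree [:0, \<mu>:] + degree (pderiv p)"
      by (rule degree_mult_le)
    also have "\<dots> \<le> 1 + (degree p - 1)" by (intro add_mono) (simp_all add: degree_pderiv)
    finally show ?thesis using False by simp
  qed
qed

lemma d_poly: "\<delta> (poly p x) = poly (map_poly \<delta> p) x + poly (pderiv p) x * \<delta> x"
  by (induction p) (simp_all add: map_poly_pCons pderiv_pCons d_add d_mult algebra_simps)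

text \<open>The coefficients are constants for \<open>\<delta>\<close>, so by the chain rule a root
  \<open>x\<close> would also be a root of the derivative, which has lower degree and constant
  coefficients again.\<close>

lemma poly_nonzero_if_transcendental:
  assumes "\<delta> x \<noteq> 0" "map_poly \<delta> p = 0" "p \<noteq> 0"
  shows "poly p x \<noteq> 0"
  using assms(2,3)
proof (induction "degree p" arbitrary: p rule: less_induct)
  case less
  show ?case
  proof (cases "degree p = 0")
    case True
    then obtain c where "p = [:c:]" by (metis degree_eq_zeroE)
    then show ?thesis using less.prems by auto
  next
    case False
    have "\<delta> (coeff p n) = 0" for n
      using arg_cong[OF less.prems(1), of "\<lambda>q. coeff q n"] by (simp add: coeff_map_poly)
    then have "map_poly \<delta> (pderiv p) = 0"
      by (intro poly_eqI) (simp add: coeff_map_poly coeff_pderiv d_mult del: of_nat_Suc)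
    then have "poly (pderiv p) x \<noteq> 0"
      using less.hyps[of "pderiv p"] False by (auto simp: degree_pderiv pderiv_eq_0_iff)
    then have "\<delta> (poly p x) \<noteq> 0" using assms(1) less.prems by (simp add: d_poly)
    then show ?thesis by auto
  qed
qed

lemma quadratic_nonzero_if_transcendental:
  assumes "\<delta> x \<noteq> 0" "\<delta> a = 0" "\<delta> b = 0" "\<delta> c = 0" "a \<noteq> 0"
  shows "a * x ^ 2 + b * x + c \<noteq> 0"
proof -
  have "poly [:c, b, a:] x \<noteq> 0"
    using assms by (intro poly_nonzero_if_transcendental) (simp_all add: map_poly_pCons)
  then show ?thesis by (simp add: algebra_simps power2_eq_square)
qed

text \<open>The coefficients of \<open>f\<close> are constants, so the derivation with
  \<open>\<mu> = 0\<close> multiplies \<open>f / D\<close> by the logarithmic derivative of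
  \<open>1 / D\<close>, while it moves \<open>x0\<close>.\<close>

lemma mordell_weil_rank_quadratic_twist:
  fixes f :: "rat poly"
  assumes f: "squarefree f" "degree f \<ge> 3"
    and "D \<noteq> 0" "y0 \<noteq> 0" "\<delta> x0 \<noteq> 0"
    and on_curve: "D * y0 ^ 2 = poly (map_poly of_rat f) x0"
  shows "mordell_weil_rank D (map_poly of_rat f) > 0"
proof -
  interpret ac: ring_morphism "to_ac :: 'k \<Rightarrow> _" by (rule ring_morphism_to_ac)
  have hom: "ring_morphism (to_ac \<circ> of_rat :: rat \<Rightarrow> 'k alg_closure)"
    by unfold_locales (simp_all add: of_rat_add of_rat_mult)
  have ac: "map_poly to_ac (map_poly of_rat f) = map_poly (to_ac \<circ> of_rat :: rat \<Rightarrow> 'k alg_closure) f"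
    by (simp add: map_poly_map_poly)
  interpret rational_point D "map_poly of_rat f" x0 y0
  proof
    show "poly (pderiv (map_poly to_ac (map_poly of_rat f))) x \<noteq> 0"
      if "poly (map_poly to_ac (map_poly of_rat f)) x = 0" for x :: "'k alg_closure"
      using squarefree_imp_simple_roots[OF f(1) hom] that unfolding ac by blast
  qed (use assms in \<open>auto simp: degree_map_poly\<close>)
  have const: "map_poly \<delta> (map_poly of_rat f) = 0"
    by (intro poly_eqI) (simp add: coeff_map_poly)
  show ?thesis
  proof (rule mordell_weil_rank_positive)
    show "poly_d 0 H = [:2 * (\<delta> (inverse D) * D / 2):] * H"
      using \<open>D \<noteq> 0\<close> by (simp add: poly_d_def H_def map_poly_d_smult const field_simps)
    show "poly (poly_d 0 [:- x0, 1:]) x0 \<noteq> 0"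
      using \<open>\<delta> x0 \<noteq> 0\<close> by (simp add: poly_d_def map_poly_pCons d_uminus)
  qed (rule poly_d_add poly_d_mult degree_poly_d)+
qed

text \<open>A derivation that annihilates the whole right-hand side of the curve equation must move
  the point, because \<open>y0\<close> is not constant.\<close>

lemma mordell_weil_rank_power_twist:
  assumes "m \<ge> 3" "D \<noteq> 0" "a \<noteq> 0" "\<delta> a = 0" "\<delta> y0 \<noteq> 0"
    and on_curve: "y0 ^ 2 = D * x0 ^ m + a ^ 2"
  shows "mordell_weil_rank 1 (monom D m + [:a ^ 2:]) > 0"
proof -
  define g where "g = monom D m + [:a ^ 2:]"
  have "y0 \<noteq> 0" using \<open>\<delta> y0 \<noteq> 0\<close> by auto
  have deg: "degree g = m"
    unfolding g_def using assms(1,2) by (subst degree_add_eq_left) (simp_all add: degree_monom_eq)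
  have pd: "pderiv g = monom (of_nat m * D) (m - 1)"
    by (simp add: g_def pderiv_add pderiv_monom pderiv_pCons)
  interpret ac: ring_morphism "to_ac :: 'k \<Rightarrow> _" by (rule ring_morphism_to_ac)
  interpret rational_point 1 g x0 y0
  proof
    fix x :: "'k alg_closure"
    assume root: "poly (map_poly to_ac g) x = 0"
    have "map_poly to_ac g = monom (to_ac D) m + [:to_ac a ^ 2:]"
      unfolding g_def by (intro poly_eqI) (simp add: coeff_map_poly coeff_pCons split: nat.splits)
    then have "x \<noteq> 0" using root \<open>m \<ge> 3\<close> \<open>a \<noteq> 0\<close> by (auto simp: poly_monom power_0_left)
    then show "poly (pderiv (map_poly to_ac g)) x \<noteq> 0"
      using \<open>m \<ge> 3\<close> \<open>D \<noteq> 0\<close>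
      by (simp add: ac.pderiv_hom pd map_poly_monom poly_monom del: of_nat_Suc)
  qed (use deg \<open>m \<ge> 3\<close> \<open>y0 \<noteq> 0\<close> on_curve in \<open>simp_all add: g_def poly_monom\<close>)
  \<comment> \<open>With this choice of \<open>\<mu>\<close> the derivation kills \<open>D x\<^sup>m\<close>.\<close>
  define \<mu> where "\<mu> = - \<delta> D / (of_nat m * D)"
  have \<mu>: "\<delta> D + \<mu> * (of_nat m * D) = 0" using assms(1,2) by (simp add: \<mu>_def)
  obtain k where k: "m = Suc k" using \<open>m \<ge> 3\<close> by (cases m) auto
  have "poly_d \<mu> g = monom (\<delta> D + \<mu> * (of_nat m * D)) m"
  proof -
    have "map_poly \<delta> g = monom (\<delta> D) m"
      using \<open>\<delta> a = 0\<close> by (intro poly_eqI)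
        (simp add: g_def coeff_map_poly coeff_pCons d_add d_power2 split: nat.splits)
    moreover have "[:0, \<mu>:] * pderiv g = monom (\<mu> * (of_nat m * D)) m"
      unfolding pd k by (simp add: monom_Suc smult_monom)
    ultimately show ?thesis by (simp add: poly_d_def add_monom)
  qed
  then have dg: "poly_d \<mu> g = 0" using \<mu> by simp
  have lin: "poly (poly_d \<mu> [:-x0, 1:]) x0 = \<mu> * x0 - \<delta> x0"
    by (simp add: poly_d_def map_poly_pCons d_uminus pderiv_pCons)
  \<comment> \<open>If \<open>\<delta> x0 = \<mu> * x0\<close> held, \<open>\<delta>\<close> would
    annihilate \<open>D * x0 ^ m\<close>, and differentiating the equation of the curve would make
    \<open>y0\<close> constant.\<close>
  have "\<mu> * x0 - \<delta> x0 \<noteq> 0"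
  proof
    assume "\<mu> * x0 - \<delta> x0 = 0"
    then have *: "\<delta> x0 = \<mu> * x0" by simp
    have "2 * y0 * \<delta> y0 = \<delta> (D * x0 ^ m + a ^ 2)" using assms(6) by (metis d_power2)
    also have "\<dots> = \<delta> D * x0 ^ m + D * (of_nat m * x0 ^ k * \<delta> x0)"
      unfolding k derivation_power[of \<delta>, OF d_mult, symmetric]
      using \<open>\<delta> a = 0\<close> by (simp add: d_add d_mult d_power2)
    also have "\<dots> = x0 ^ m * (\<delta> D + \<mu> * (of_nat m * D))"
      unfolding * k by (simp add: algebra_simps)
    finally show False using \<mu> \<open>y0 \<noteq> 0\<close> \<open>\<delta> y0 \<noteq> 0\<close> by simp
  qed
  then show ?thesis
    unfolding g_def[symmetric]
    by (intro mordell_weil_rank_positive[of "poly_d \<mu>" 0] poly_d_add poly_d_mult degree_poly_d)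
      (simp_all add: lin H_def dg)
qed

section \<open>A common value at which three linear factors are squares\<close>

lemma simultaneous_square_component:
  assumes "D0 = - 8 * (s + t - r) * (r + t - s) * (r + s - t) / \<Delta> ^ 2" "\<Delta> \<noteq> 0"
    and \<Delta>: "\<Delta> = r ^ 2 + s ^ 2 + t ^ 2 - 2 * r * s - 2 * r * t - 2 * s * t"
    and d: "\<delta> (r * (s + t - r)) * \<Delta> - r * (s + t - r) * \<delta> \<Delta> \<noteq> 0"
  shows "\<exists>y. 1 + r * D0 = y ^ 2 \<and> \<delta> y \<noteq> 0"
proof (intro exI conjI)
  \<comment> \<open>For non-zero \<open>r\<close>, \<open>s\<close>, \<open>t\<close> the quotient
    \<open>\<Delta> / (4 * r * s * t)\<close> is the abscissa of the double of
    \<open>(0, 1)\<close>, and \<open>D0\<close> that of the triple. The square root sought is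
    \<open>1 + 4 * q\<close>; the other factors follow by permuting the letters.\<close>
  define q where "q = r * (s + t - r) / \<Delta>"
  have q: "q * \<Delta> = r * (s + t - r)" using assms(2) by (simp add: q_def)
  define W where "W = r * (s + t - r)"
  \<comment> \<open>This factorisation accounts for the product of three linear forms in
    \<open>D0\<close>.\<close>
  have W: "\<Delta> + 2 * W = - ((r + t - s) * (r + s - t))"
    unfolding \<Delta> W_def by (simp add: algebra_simps power2_eq_square)
  have "(\<Delta> + 4 * W) ^ 2 = \<Delta> ^ 2 + 8 * W * (\<Delta> + 2 * W)"
    by (simp add: algebra_simps power2_eq_square)
  then have "\<Delta> ^ 2 + r * (- 8 * (s + t - r) * (r + t - s) * (r + s - t))
      = (\<Delta> + 4 * (r * (s + t - r))) ^ 2"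
    unfolding W unfolding W_def by (simp add: algebra_simps)
  moreover have "D0 * \<Delta> ^ 2 = - 8 * (s + t - r) * (r + t - s) * (r + s - t)"
    using assms(1,2) by simp
  ultimately have "\<Delta> ^ 2 + r * (D0 * \<Delta> ^ 2) = (\<Delta> + 4 * (q * \<Delta>)) ^ 2"
    unfolding q by simp
  then have "\<Delta> ^ 2 * (1 + r * D0) = \<Delta> ^ 2 * (1 + 4 * q) ^ 2"
    by (simp add: algebra_simps power2_eq_square)
  then show "1 + r * D0 = (1 + 4 * q) ^ 2" using \<open>\<Delta> \<noteq> 0\<close> by simp
  \<comment> \<open>By the quotient rule the expression in the last hypothesis is the numerator of
    \<open>\<delta> q\<close>.\<close>
  show "\<delta> (1 + 4 * q) \<noteq> 0"
  proof
    assume "\<delta> (1 + 4 * q) = 0"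
    then have "\<delta> q = 0" by (simp add: d_add d_mult)
    then have "\<delta> (r * (s + t - r)) = q * \<delta> \<Delta>" by (simp add: d_mult flip: q)
    then show False using d by (simp add: q[symmetric] mult_ac)
  qed
qed

text \<open>With \<open>r\<close> moving and \<open>s\<close>, \<open>t\<close> constant, the
  non-vanishing conditions reduce to quadratic polynomials in \<open>r\<close> with constant
  coefficients and non-zero leading coefficient. For the first factor that coefficient is
  \<open>s + t\<close>.\<close>

lemma simultaneous_squares:
  assumes "\<delta> r \<noteq> 0" "\<delta> s = 0" "\<delta> t = 0" "s \<noteq> 0" "t \<noteq> 0" "s + t \<noteq> 0"
  obtains D0 y1 y2 y3 where "D0 \<noteq> 0" "1 + r * D0 = y1 ^ 2" "1 + s * D0 = y2 ^ 2"
    "1 + t * D0 = y3 ^ 2" "\<delta> y1 \<noteq> 0" "\<delta> y2 \<noteq> 0" "\<delta> y3 \<noteq> 0"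
proof -
  define \<Delta> where "\<Delta> = r ^ 2 + s ^ 2 + t ^ 2 - 2 * r * s - 2 * r * t - 2 * s * t"
  define D0 where "D0 = - 8 * (s + t - r) * (r + t - s) * (r + s - t) / \<Delta> ^ 2"
  note dsimps = assms(2,3) d_add d_diff d_mult d_uminus d_power2
  have "1 * r ^ 2 + (- 2 * (s + t)) * r + (s - t) ^ 2 \<noteq> 0"
    by (rule quadratic_nonzero_if_transcendental) (use assms in \<open>simp_all add: dsimps\<close>)
  then have "\<Delta> \<noteq> 0" by (simp add: \<Delta>_def algebra_simps power2_eq_square)
  have d\<Delta>: "\<delta> \<Delta> = 2 * (r - s - t) * \<delta> r"
    by (simp add: \<Delta>_def dsimps algebra_simps)
  obtain y1 where y1: "1 + r * D0 = y1 ^ 2" "\<delta> y1 \<noteq> 0"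
  proof -
    have "(s + t) * r ^ 2 + (- 2 * (s - t) ^ 2) * r + (s + t) * (s - t) ^ 2 \<noteq> 0"
      by (rule quadratic_nonzero_if_transcendental) (use assms in \<open>simp_all add: dsimps\<close>)
    moreover have "\<delta> (r * (s + t - r)) * \<Delta> - r * (s + t - r) * \<delta> \<Delta>
        = \<delta> r * ((s + t) * r ^ 2 + (- 2 * (s - t) ^ 2) * r + (s + t) * (s - t) ^ 2)"
      unfolding d\<Delta> unfolding \<Delta>_def by (simp add: dsimps algebra_simps power2_eq_square)
    ultimately have "\<delta> (r * (s + t - r)) * \<Delta> - r * (s + t - r) * \<delta> \<Delta> \<noteq> 0"
      using assms(1) by simp
    then show thesis
      using simultaneous_square_component[OF D0_def \<open>\<Delta> \<noteq> 0\<close> \<Delta>_def] that by blast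
  qed
  \<comment> \<open>The second and third factors differ by exchanging \<open>s\<close> and
    \<open>t\<close>. Here the leading coefficient of the quadratic is \<open>- 1\<close>.\<close>
  have other: "\<exists>y. 1 + s * D0 = y ^ 2 \<and> \<delta> y \<noteq> 0"
    if *: "\<delta> s = 0" "\<delta> t = 0" "s \<noteq> 0"
      "\<Delta> = s ^ 2 + r ^ 2 + t ^ 2 - 2 * s * r - 2 * s * t - 2 * r * t"
      "D0 = - 8 * (r + t - s) * (s + t - r) * (s + r - t) / \<Delta> ^ 2" for s t
  proof -
    have "(- 1) * r ^ 2 + (2 * (s - t)) * r + ((s - t) ^ 2 - 2 * (s + t) * (s - t)) \<noteq> 0"
      by (rule quadratic_nonzero_if_transcendental)
        (use assms(1) * in \<open>simp_all add: d_add d_diff d_mult d_uminus d_power2\<close>)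
    moreover have "\<delta> \<Delta> = 2 * (r - s - t) * \<delta> r"
      unfolding *(4) using *(1,2)
      by (simp add: d_add d_diff d_mult d_uminus d_power2 algebra_simps)
    then have "\<delta> (s * (r + t - s)) * \<Delta> - s * (r + t - s) * \<delta> \<Delta>
        = \<delta> r * s * ((- 1) * r ^ 2 + (2 * (s - t)) * r + ((s - t) ^ 2 - 2 * (s + t) * (s - t)))"
      using *(1,2) unfolding *(4)
      by (simp add: d_add d_diff d_mult algebra_simps power2_eq_square)
    ultimately have "\<delta> (s * (r + t - s)) * \<Delta> - s * (r + t - s) * \<delta> \<Delta> \<noteq> 0"
      using assms(1) *(3) by simp
    then show ?thesis
      using simultaneous_square_component[OF *(5) \<open>\<Delta> \<noteq> 0\<close> *(4)] by blast
  qed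
  obtain y2 where y2: "1 + s * D0 = y2 ^ 2" "\<delta> y2 \<noteq> 0"
    using other[of s t] assms by (auto simp: \<Delta>_def D0_def algebra_simps)
  obtain y3 where y3: "1 + t * D0 = y3 ^ 2" "\<delta> y3 \<noteq> 0"
    using other[of t s] assms by (auto simp: \<Delta>_def D0_def algebra_simps)
  \<comment> \<open>For \<open>D0 = 0\<close> the value \<open>y1\<close> would be a square root of
    1, hence a constant.\<close>
  have "D0 \<noteq> 0"
  proof
    assume "D0 = 0"
    then have "y1 ^ 2 = 1" using y1 by simp
    then have "2 * y1 * \<delta> y1 = 0" by (metis d_one d_power2)
    then show False using y1(2) \<open>y1 ^ 2 = 1\<close> by simp
  qed
  then show thesis using that y1 y2 y3 by blast
qed

end

section \<open>Differentiation with respect to the outermost variable\<close>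

definition fract_deriv :: "'a::{idom, semiring_no_zero_divisors} poly fract \<Rightarrow> 'a poly fract" where
  "fract_deriv r = (THE s. \<exists>p q. q \<noteq> 0 \<and> r = Fract p q \<and>
     s = Fract (pderiv p * q - p * pderiv q) (q * q))"

text \<open>For two representations of one fraction, the cross-multiplied difference of the quotient
  rules is a combination of the relation \<open>p * q' = p' * q\<close> and its derivative.\<close>

lemma fract_deriv_Fract:
  assumes "q \<noteq> 0"
  shows "fract_deriv (Fract p q) = Fract (pderiv p * q - p * pderiv q) (q * q)"
  unfolding fract_deriv_def
proof (rule the_equality)
  fix s assume "\<exists>p' q'. q' \<noteq> 0 \<and> Fract p q = Fract p' q' \<and>
     s = Fract (pderiv p' * q' - p' * pderiv q') (q' * q')"
  then obtain p' q' where *: "q' \<noteq> 0" "Fract p q = Fract p' q'"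
    "s = Fract (pderiv p' * q' - p' * pderiv q') (q' * q')" by blast
  have eq: "p * q' = p' * q" using * assms by (simp add: eq_fract)
  have eq': "pderiv p * q' + p * pderiv q' = pderiv p' * q + p' * pderiv q"
    using arg_cong[OF eq, of pderiv] by (simp add: pderiv_mult algebra_simps)
  have "(pderiv p' * q' - p' * pderiv q') * (q * q) - (pderiv p * q - p * pderiv q) * (q' * q')
      = (q * q') * (pderiv p' * q + p' * pderiv q - (pderiv p * q' + p * pderiv q'))
        + (p * q' - p' * q) * (q' * pderiv q + q * pderiv q')"
    by (simp add: algebra_simps)
  also have "\<dots> = 0" unfolding eq eq' by simp
  finally show "s = Fract (pderiv p * q - p * pderiv q) (q * q)"
    unfolding *(3) using assms *(1) by (simp add: eq_fract)
qed (use assms in blast)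

lemma field_derivation_fract_deriv:
  "field_derivation (fract_deriv :: 'a::{idom, ring_char_0} poly fract \<Rightarrow> _)"
proof
  fix a b :: "'a poly fract"
  obtain p q d where d: "d \<noteq> 0" and ab: "a = Fract p d" "b = Fract q d"
    by (rule Fract_common_denominator)
  have "a + b = Fract (p + q) d" using d by (simp add: ab eq_fract algebra_simps)
  then show "fract_deriv (a + b) = fract_deriv a + fract_deriv b"
    unfolding ab using d by (simp add: fract_deriv_Fract[OF d] eq_fract pderiv_add algebra_simps
        del: add_fract) (simp add: eq_fract algebra_simps)
  show "fract_deriv (a * b) = fract_deriv a * b + a * fract_deriv b"
    using d by (simp add: ab fract_deriv_Fract eq_fract pderiv_mult algebra_simps)
qed

section \<open>Choice of the common twist\<close>

theorem theorem2p2: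
  fixes f :: "rat poly" and m1 m2 m3 :: nat and a b c :: rat
  assumes "squarefree f" and "degree f \<ge> 3"
    and "odd m1" and "m1 \<ge> 3" and "odd m2" and "m2 \<ge> 3" and "odd m3" and "m3 \<ge> 3"
    and "a \<noteq> 0" and "b \<noteq> 0" and "c \<noteq> 0"
  shows "\<exists>D :: rat_fun4. D \<noteq> 0 \<and>
    mordell_weil_rank D (map_poly of_rat f) > 0 \<and>
    mordell_weil_rank 1 (monom D m1 + [:of_rat a ^ 2:]) > 0 \<and>
    mordell_weil_rank 1 (monom D m2 + [:of_rat b ^ 2:]) > 0 \<and>
    mordell_weil_rank 1 (monom D m3 + [:of_rat c ^ 2:]) > 0"
proof -
  define \<delta> :: "rat_fun4 \<Rightarrow> rat_fun4" where "\<delta> = fract_deriv"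
  interpret field_derivation \<delta> unfolding \<delta>_def by (rule field_derivation_fract_deriv)
  \<comment> \<open>The outermost variable; \<open>\<delta>\<close> differentiates with respect to
    it and treats the other three as constants.\<close>
  define z :: rat_fun4 where "z = Fract [:0, 1:] 1"
  have "\<delta> z = 1"
    by (simp add: \<delta>_def z_def fract_deriv_Fract pderiv_pCons One_fract_def eq_fract)
  then have "z \<noteq> 0" by auto
  define F where "F = poly (map_poly of_rat f) z"
  have "F \<noteq> 0" unfolding F_def
  proof (rule poly_nonzero_if_transcendental)
    show "map_poly \<delta> (map_poly of_rat f) = 0" by (intro poly_eqI) (simp add: coeff_map_poly)
    show "map_poly of_rat f \<noteq> (0 :: rat_fun4 poly)"
      using assms(2) by (auto simp: map_poly_eq_0_iff)
  qed (simp add: \<open>\<delta> z = 1\<close>)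
  \<comment> \<open>Multiplied by \<open>a ^ 2\<close>, the equation
    \<open>1 + r * D0 = y1 ^ 2\<close> becomes \<open>a ^ 2 + D0 * z ^ m1 = (a * y1) ^ 2\<close>.
    The power of \<open>z\<close> makes \<open>r\<close> non-constant.\<close>
  define r s t :: rat_fun4 where "r = of_rat (1 / a ^ 2) * z ^ m1"
    and "s = of_rat (1 / b ^ 2)" and "t = of_rat (1 / c ^ 2)"
  obtain D0 y1 y2 y3 where D0: "D0 \<noteq> 0"
    and y: "1 + r * D0 = y1 ^ 2" "1 + s * D0 = y2 ^ 2" "1 + t * D0 = y3 ^ 2"
    and dy: "\<delta> y1 \<noteq> 0" "\<delta> y2 \<noteq> 0" "\<delta> y3 \<noteq> 0"
  proof (rule simultaneous_squares[of r s t])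
    obtain k where k: "m1 = Suc k" using assms(4) by (cases m1) auto
    have "\<delta> r = of_rat (1 / a ^ 2) * (of_nat (Suc k) * z ^ k)"
      unfolding r_def k d_mult derivation_power[of \<delta>, OF d_mult] \<open>\<delta> z = 1\<close>
      by (simp del: of_nat_Suc)
    then show "\<delta> r \<noteq> 0" using assms(9) \<open>z \<noteq> 0\<close> by (simp del: of_nat_Suc)
    \<comment> \<open>Positivity over the rationals excludes cancellation in
      \<open>s + t\<close>.\<close>
    have "1 / b ^ 2 + 1 / c ^ 2 > 0" using assms(10,11) by (simp add: add_pos_pos)
    then show "s + t \<noteq> 0" unfolding s_def t_def of_rat_add[symmetric] by simp
  qed (use assms in \<open>simp_all add: s_def t_def\<close>)
  \<comment> \<open>Multiplying \<open>D0\<close> by an \<open>M\<close>-th power only rescales the points on the three power twists,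
    and since \<open>M\<close> is odd it can be chosen to turn \<open>D0\<close> into \<open>f(z)\<close> times a square.\<close>
  define M where "M = m1 * m2 * m3"
  define \<kappa> where "\<kappa> = D0 * F"
  define D where "D = D0 * \<kappa> ^ M"
  have "\<kappa> \<noteq> 0" using D0 \<open>F \<noteq> 0\<close> by (simp add: \<kappa>_def)
  then have "D \<noteq> 0" using D0 by (simp add: D_def)
  have "odd M" using assms by (simp add: M_def)
  then obtain j where j: "M = 2 * j + 1" by (elim oddE)
  \<comment> \<open>Since \<open>\<kappa>\<close> contains the factor \<open>D0\<close>, its odd
    power completes \<open>D0\<close> to a square, so that \<open>D = F * \<eta> ^ 2\<close> and
    \<open>(z, 1 / \<eta>)\<close> lies on the quadratic twist.\<close>
  define \<eta> where "\<eta> = D0 * \<kappa> ^ j"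
  have "\<eta> \<noteq> 0" using D0 \<open>\<kappa> \<noteq> 0\<close> by (simp add: \<eta>_def)
  have "D = D0 * (\<kappa> * (\<kappa> ^ j) ^ 2)" by (simp add: D_def j power_even_eq)
  also have "\<dots> = F * \<eta> ^ 2"
    unfolding \<eta>_def using \<kappa>_def by (simp add: power2_eq_square mult_ac)
  finally have "D * inverse \<eta> ^ 2 = F"
    using \<open>\<eta> \<noteq> 0\<close> by (simp add: power2_eq_square field_simps)
  then have rank0: "mordell_weil_rank D (map_poly of_rat f) > 0"
    using \<open>\<eta> \<noteq> 0\<close> \<open>D \<noteq> 0\<close> assms(1,2) \<open>\<delta> z = 1\<close>
    by (intro mordell_weil_rank_quadratic_twist[of f D "inverse \<eta>" z]) (simp_all add: F_def)
  \<comment> \<open>Here \<open>k = M / m\<close>: dividing the abscissa by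
    \<open>\<kappa> ^ k\<close> cancels the factor \<open>\<kappa> ^ M\<close> of \<open>D\<close>,
    so the points found for \<open>D0\<close> carry over.\<close>
  have rank: "mordell_weil_rank 1 (monom D m + [:of_rat e ^ 2:]) > 0"
    if "m \<ge> 3" "M = m * k" "e \<noteq> 0" "1 + of_rat (1 / e ^ 2) * \<xi> ^ m * D0 = y ^ 2" "\<delta> y \<noteq> 0"
    for m k e \<xi> y
  proof (rule mordell_weil_rank_power_twist[where ?x0.0 = "\<xi> / \<kappa> ^ k" and ?y0.0 = "of_rat e * y"])
    have "D * (\<xi> / \<kappa> ^ k) ^ m = D0 * \<xi> ^ m"
      using \<open>\<kappa> \<noteq> 0\<close> that(2) by (simp add: D_def power_divide mult.commute flip: power_mult)
    moreover have "(of_rat e * y) ^ 2 = of_rat e ^ 2 + D0 * \<xi> ^ m"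
      using that(3) by (simp add: power_mult_distrib that(4)[symmetric] of_rat_divide of_rat_power
          field_simps)
    ultimately show "(of_rat e * y) ^ 2 = D * (\<xi> / \<kappa> ^ k) ^ m + of_rat e ^ 2" by simp
  qed (use that \<open>D \<noteq> 0\<close> in \<open>simp_all add: d_mult\<close>)
  have "mordell_weil_rank 1 (monom D m1 + [:of_rat a ^ 2:]) > 0"
    using rank[of m1 "m2 * m3" a z y1] assms y(1) dy(1) by (simp add: M_def r_def mult.assoc)
  moreover have "mordell_weil_rank 1 (monom D m2 + [:of_rat b ^ 2:]) > 0"
    using rank[of m2 "m1 * m3" b 1 y2] assms y(2) dy(2) by (simp add: M_def s_def mult_ac)
  moreover have "mordell_weil_rank 1 (monom D m3 + [:of_rat c ^ 2:]) > 0"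
    using rank[of m3 "m1 * m2" c 1 y3] assms y(3) dy(3) by (simp add: M_def t_def mult_ac)
  ultimately show ?thesis using rank0 \<open>D \<noteq> 0\<close> by blast
qed

end
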